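(* Let $\Phi$ be a jointly antisymmetric admissible flux interpolation and let $(r^0,\eta^0)\in L^2_\mu(\mathbb{R}^d)\times C_b(D)$ with $\eta^0$ symmetric. Let $V:[0,T]\times L^2_\mu(\mathbb{R}^d)\to\mathcal{V}^{\mathrm{as}}(D)$ satisfy, for some constant $C_V>0$, at least one of the two bounds $$\int_0^T\sup_{r\in L^2_\mu(\mathbb{R}^d)}\sup_{x\in\mathbb{R}^d}\int_{\mathbb{R}^d\setminus\{x\}}|V_t[r](x,y)|^2\,d\mu(y)\,dt\le C_V$$ or $$\sup_{t\in[0,T]}\sup_{r\in L^2_\mu(\mathbb{R}^d)}\sup_{x\in\mathbb{R}^d}\int_{\mathbb{R}^d\setminus\{x\}}|V_t[r](x,x')|^2\,d\mu(x')\le C_V ,$$ and, for some constant $L_V>0$, for all $t\in[0,T]$ and all $g,\tilde g\in L^2_\mu(\mathbb{R}^d)$, $$\sup_{x\in\mathbb{R}^d}\int_{\mathbb{R}^d\setminus\{x\}}|V_t[g](x,x')-V_t[\tilde g](x,x')|^2\,d\mu(x')\le L_V\|g-\tilde g\|^2_{L^2_\mu(\mathbb{R}^d)} .$$ Let $\omega:[0,T]\times L^2_\mu(\mathbb{R}^d)\times D\to\mathbb{R}$ be such that: $(x,y)\mapsto\omega_t[r](x,y)$ is continuous on $D$ and $t\mapsto\omega_t[\cdot](\cdot,\cdot)$ is in $L^1([0,T])$; there is $L_\omega\ge0$ with $\sup_{t\in[0,T]}\sup_{(x,y)\in D}|\omega_t[r](x,y)-\omega_t[\tilde r](x,y)|\le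 L_\omega\|r-\tilde r\|_{L^2_\mu(\mathbb{R}^d)}$ for all $r,\tilde r\in L^2_\mu(\mathbb{R}^d)$; there is $C_\omega>0$ with $\sup_{t\in[0,T]}\sup_{r\in L^2_\mu(\mathbb{R}^d)}\sup_{(x,y)\in D}|\omega_t[r](x,y)|\le C_\omega$; and $(x,y)\mapsto\omega_t[r](x,y)$ is symmetric. Then there exists a solution $(r,\eta)$ of the Euler Co-NCL system on $[0,T]$ with initial datum $(r^0,\eta^0)$.
   Context: Fix $T>0$, $d\ge1$ and a Borel probability measure $\mu$ on $\mathbb{R}^d$ with finite second moment. Let $D:=\{(x,y)\in\mathbb{R}^d\times\mathbb{R}^d: x\ne y\}$; $C_b(D)$ is the space of bounded continuous real functions on $D$ with the supremum norm; $\mathcal{V}^{\mathrm{as}}(D):=\{v:D\to\mathbb{R}: v(x,y)=-v(y,x)\}$. A function $h$ on $D$ is symmetric if $h(x,y)=h(y,x)$. A measurable $\Phi:\mathbb{R}^3\to\mathbb{R}$ is an admissible flux interpolation if: (i) $\Phi(0,0;v)=\Phi(a,b;0)=0$ for all $a,b,v\in\mathbb{R}$; (ii) for some $L_\Phi>0$ and all real $a,b,c,d,v,w$: $|\Phi(a,b;w)-\Phi(a,b;v)|\le L_\Phi(|a|+|b|)|w-v|$ and $|\Phi(a,b;v)-\Phi(c,d;v)|\le L_\Phi(|a-c|+|b-d|)|v|$; (iii) $\Phi(\alpha a,\alpha b;w)=\alpha\Phi(a,b;w)$ for all $\alpha>0$. It is jointly antisymmetric if $\Phi(a,b;-v)=-\Phi(b,a;v)$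 for all $a,b,v$. Along a curve $t\mapsto r_t$, the notations $V_t[r]$ and $\omega_t[r]$ mean $V_t[r_t]$ and $\omega_t[r_t]$. $V$ and $\omega$ are understood to be measurable so that all integrals written make sense. A pair $(r,\eta):[0,T]\to L^2_\mu(\mathbb{R}^d)\times C_b(D)$ is a solution of the Euler Co-NCL system with initial datum $(r_0,\eta_0)$ if: (1) the maps $t\mapsto\int_{\mathbb{R}^d\setminus\{x\}}\Phi(r_t(x),r_t(y);V_t[r](x,y))\eta_t(x,y)\,d\mu(y)$ (for $\mu$-a.e. $x$) and $t\mapsto\omega_t[r](x,y)-\eta_t(x,y)$ (for $(x,y)\in D$) belong to $L^1([0,T])$; (2) for $\mu$-a.e. $x\in\mathbb{R}^d$, all $t\in[0,T]$ and all $(x,y)\in D$, $$r_t(x)=r_0(x)-\int_0^t\int_{\mathbb{R}^d\setminus\{x\}}\Phi(r_s(x),r_s(y);V_s[r](x,y))\,\eta_s(x,y)\,d\mu(y)\,ds,$$ $$\eta_t(x,y)=\eta_0(x,y)+\int_0^t\big(\omega_s[r](x,y)-\eta_s(x,y)\big)\,ds;$$ (3) $r\in AC([0,T],L^2_\mu(\mathbb{R}^d))$ and $\eta\in AC([0,T],C_b(D))$, where a curve $\gamma$ in a normed space $S$ is in $AC([0,T],S)$ if there is $m\in L^1([0,T])$ with $\|\gamma_t-\gamma_s\|_S\le\int_s^t m(u)\,du$ for all $0\le s<t\le T$. *)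

theory Defs
  imports "HOL-Analysis.Analysis" "HOL-Probability.Probability"
begin

definition offdiag :: "('a \<times> 'a) set" where
  "offdiag = {(x, y). x \<noteq> y}"

text \<open>
  A function on \<^term>\<open>offdiag\<close> is represented by a function on all pairs, whose values on the
  diagonal are never used.
\<close>

definition sym_fun :: "('a \<times> 'a \<Rightarrow> real) \<Rightarrow> bool" where
  "sym_fun h \<longleftrightarrow> (\<forall>x y. (x, y) \<in> offdiag \<longrightarrow> h (x, y) = h (y, x))"

definition antisym_fun :: "('a \<times> 'a \<Rightarrow> real) \<Rightarrow> bool" where
  "antisym_fun v \<longleftrightarrow> (\<forall>x y. (x, y) \<in> offdiag \<longrightarrow> v (x, y) = - v (y, x))"

definition Cb_offdiag :: "('a::topological_space \<times> 'a \<Rightarrow> real) set" where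
  "Cb_offdiag = {f. continuous_on offdiag f \<and> bounded (f ` offdiag)}"

definition sup_norm :: "('a \<times> 'a \<Rightarrow> real) \<Rightarrow> real" where
  "sup_norm f = (SUP p\<in>offdiag. \<bar>f p\<bar>)"

text \<open>
  Elements of \<open>L\<^sup>2\<close> are represented by functions rather than by classes modulo almost-everywhere
  equality; \<open>ae_invariant\<close> says that a time-dependent map given on representatives is a map
  on classes.
\<close>

definition L2 :: "'a measure \<Rightarrow> ('a \<Rightarrow> real) set" where
  "L2 M = {r. r \<in> borel_measurable M \<and> integrable M (\<lambda>x. (r x)\<^sup>2)}"

definition L2_norm :: "'a measure \<Rightarrow> ('a \<Rightarrow> real) \<Rightarrow> real" where
  "L2_norm M r = sqrt (\<integral>x. (r x)\<^sup>2 \<partial>M)"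

definition ae_invariant ::
    "real \<Rightarrow> 'a measure \<Rightarrow> (real \<Rightarrow> ('a \<Rightarrow> real) \<Rightarrow> 'a \<times> 'a \<Rightarrow> real) \<Rightarrow> bool" where
  "ae_invariant T M F \<longleftrightarrow>
     (\<forall>t\<in>{0..T}. \<forall>r\<in>L2 M. \<forall>r'\<in>L2 M.
        (AE x in M. r x = r' x) \<longrightarrow> (\<forall>p\<in>offdiag. F t r p = F t r' p))"

definition flux_interpolation :: "(real \<Rightarrow> real \<Rightarrow> real \<Rightarrow> real) \<Rightarrow> bool" where
  "flux_interpolation \<Phi> \<longleftrightarrow>
     (\<lambda>(a, b, v). \<Phi> a b v) \<in> borel_measurable borel \<and>
     (\<forall>a b v. \<Phi> 0 0 v = 0 \<and> \<Phi> a b 0 = 0) \<and>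
     (\<exists>L>0. \<forall>a b c d v w.
        \<bar>\<Phi> a b w - \<Phi> a b v\<bar> \<le> L * (\<bar>a\<bar> + \<bar>b\<bar>) * \<bar>w - v\<bar> \<and>
        \<bar>\<Phi> a b v - \<Phi> c d v\<bar> \<le> L * (\<bar>a - c\<bar> + \<bar>b - d\<bar>) * \<bar>v\<bar>) \<and>
     (\<forall>\<alpha> a b w. \<alpha> > 0 \<longrightarrow> \<Phi> (\<alpha> * a) (\<alpha> * b) w = \<alpha> * \<Phi> a b w)"

definition jointly_antisym :: "(real \<Rightarrow> real \<Rightarrow> real \<Rightarrow> real) \<Rightarrow> bool" where
  "jointly_antisym \<Phi> \<longleftrightarrow> (\<forall>a b v. \<Phi> a b (- v) = - \<Phi> b a v)"

definition sup_sq_integral :: "'a measure \<Rightarrow> ('a \<times> 'a \<Rightarrow> real) \<Rightarrow> ennreal" where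
  "sup_sq_integral M v = (SUP x. \<integral>\<^sup>+ y \<in> UNIV - {x}. ennreal (\<bar>v (x, y)\<bar>\<^sup>2) \<partial>M)"

text \<open>
  Absolutely continuous curves in a space \<open>S\<close> of real functions with norm \<open>N\<close>.
\<close>

definition AC_curve ::
    "real \<Rightarrow> ('b \<Rightarrow> real) set \<Rightarrow> (('b \<Rightarrow> real) \<Rightarrow> real) \<Rightarrow> (real \<Rightarrow> 'b \<Rightarrow> real) \<Rightarrow> bool" where
  "AC_curve T S N \<gamma> \<longleftrightarrow>
     (\<forall>t\<in>{0..T}. \<gamma> t \<in> S) \<and>
     (\<exists>m. m absolutely_integrable_on {0..T} \<and>
        (\<forall>s t. 0 \<le> s \<and> s < t \<and> t \<le> T \<longrightarrow>
           N (\<lambda>z. \<gamma> t z - \<gamma> s z) \<le> (LINT u:{s..t}|lebesgue. m u)))"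

definition flux_integral ::
    "'a measure \<Rightarrow> (real \<Rightarrow> real \<Rightarrow> real \<Rightarrow> real) \<Rightarrow> (real \<Rightarrow> ('a \<Rightarrow> real) \<Rightarrow> 'a \<times> 'a \<Rightarrow> real) \<Rightarrow>
     (real \<Rightarrow> 'a \<Rightarrow> real) \<Rightarrow> (real \<Rightarrow> 'a \<times> 'a \<Rightarrow> real) \<Rightarrow> real \<Rightarrow> 'a \<Rightarrow> real" where
  "flux_integral M \<Phi> V r \<eta> t x =
     (LINT y:UNIV - {x}|M. \<Phi> (r t x) (r t y) (V t (r t) (x, y)) * \<eta> t (x, y))"

text \<open>
  The first clause makes explicit that the inner integral exists for almost every time: the
  Bochner integral of a non-integrable function is \<open>0\<close> by convention.  The equations at \<open>t = 0\<close>
  say that the initial datum is attained.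
\<close>

definition CoNCL_solution ::
    "real \<Rightarrow> 'a::topological_space measure \<Rightarrow> (real \<Rightarrow> real \<Rightarrow> real \<Rightarrow> real) \<Rightarrow>
     (real \<Rightarrow> ('a \<Rightarrow> real) \<Rightarrow> 'a \<times> 'a \<Rightarrow> real) \<Rightarrow> (real \<Rightarrow> ('a \<Rightarrow> real) \<Rightarrow> 'a \<times> 'a \<Rightarrow> real) \<Rightarrow>
     ('a \<Rightarrow> real) \<Rightarrow> ('a \<times> 'a \<Rightarrow> real) \<Rightarrow>
     (real \<Rightarrow> 'a \<Rightarrow> real) \<Rightarrow> (real \<Rightarrow> 'a \<times> 'a \<Rightarrow> real) \<Rightarrow> bool" where
  "CoNCL_solution T M \<Phi> V \<omega> r0 \<eta>0 r \<eta> \<longleftrightarrow>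
     (AE x in M. AE t in lebesgue_on {0..T}.
        set_integrable M (UNIV - {x})
          (\<lambda>y. \<Phi> (r t x) (r t y) (V t (r t) (x, y)) * \<eta> t (x, y))) \<and>
     (AE x in M. (\<lambda>t. flux_integral M \<Phi> V r \<eta> t x) absolutely_integrable_on {0..T}) \<and>
     (\<forall>p\<in>offdiag. (\<lambda>t. \<omega> t (r t) p - \<eta> t p) absolutely_integrable_on {0..T}) \<and>
     (AE x in M. \<forall>t\<in>{0..T}.
        r t x = r0 x - (LINT s:{0..t}|lebesgue. flux_integral M \<Phi> V r \<eta> s x)) \<and>
     (\<forall>t\<in>{0..T}. \<forall>p\<in>offdiag.
        \<eta> t p = \<eta>0 p + (LINT s:{0..t}|lebesgue. \<omega> s (r s) p - \<eta> s p)) \<and>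
     AC_curve T (L2 M) (L2_norm M) r \<and>
     AC_curve T Cb_offdiag sup_norm \<eta>"

end

theory Submission
  imports Defs
begin

text \<open>
  The flux is only locally Lipschitz in the density, since the velocity depends on the density and
  is multiplied by it. All estimates are made pointwise in \<open>x\<close>, relative to the weight
  \<open>\<alpha> = \<bar>r0\<bar> + 1\<close>, which lies in \<open>L\<^sup>2\<close>. For curves with \<open>\<bar>r t x\<bar> \<le> R * \<alpha> x\<close> the Cauchy-Schwarz inequality
  bounds the flux at \<open>x\<close> by a constant times \<open>B t * \<alpha> x\<close>, where \<open>B t\<close> controls the \<open>L\<^sup>2\<close> norm of
  the velocity, and likewise bounds the difference of two fluxes. Hence the Picard map on pairs
  \<open>(r, \<eta>)\<close> can be iterated in a weighted supremum norm, and the iterates converge at every \<open>x\<close>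
  and not merely almost everywhere.

  As \<open>B\<close> is only integrable in time, the norm carries a further time weight \<open>w\<close> with
  \<open>\<integral>\<^sub>0\<^sup>t g w \<le> w t / 2\<close> for a given rate \<open>g\<close>; the choice \<open>w t = exp (4 \<integral>\<^sub>0\<^sup>t g)\<close> works. One such
  weight bounds the iterates, another makes the map a contraction.
\<close>

section \<open>Time integrals and geometric convergence\<close>

text \<open>The a priori bounds depend on each other in one direction only. Since \<omega> is
  bounded independently of the density, \<eta> has a bound that does not involve r. With that bound
  inserted, the flux estimate is linear in the size of r, so r cannot blow up before T. A Lipschitz
  constant for the flux needs both bounds. Hence there are two weights for the bounds
  (\<open>weight_\<eta>\<close>, \<open>weight_r\<close>) and a third for the contraction.

  The summand 1 in \<alpha> keeps it away from 0: integrating over y leaves the constant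
  \<open>N\<close>, the L2 norm of \<alpha>, beside \<alpha> x, and \<open>N\<close> is at most
  \<open>N * \<alpha> x\<close>.

  The 1/2 in the weight inequality serves twice. A bound of twice the initial size times w
  reproduces itself, because 1 + w is at most 2 * w; and the Picard map halves distances.

  No point x is ever discarded. The only exceptional set is the null set \<open>{0..T} - S\<close>
  of times, which depends on neither x nor the density.\<close>

definition growth_weight :: "real \<Rightarrow> (real \<Rightarrow> real) \<Rightarrow> (real \<Rightarrow> real) \<Rightarrow> bool" where
  "growth_weight T g w \<longleftrightarrow>
     mono_on {0..T} w \<and> (\<forall>t\<in>{0..T}. 1 \<le> w t) \<and> (\<lambda>s. g s * w s) integrable_on {0..T} \<and>
     (\<forall>t\<in>{0..T}. integral {0..t} (\<lambda>s. g s * w s) \<le> w t / 2)"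

lemma growth_weightD:
  assumes "growth_weight T g w"
  shows "0 \<le> s \<Longrightarrow> s \<le> t \<Longrightarrow> t \<le> T \<Longrightarrow> w s \<le> w t"
    and "t \<in> {0..T} \<Longrightarrow> 1 \<le> w t"
    and "(\<lambda>s. g s * w s) integrable_on {0..T}"
    and "t \<in> {0..T} \<Longrightarrow> integral {0..t} (\<lambda>s. g s * w s) \<le> w t / 2"
  using assms mono_onD[of "{0..T}" w s t] unfolding growth_weight_def by simp_all

lemma growth_weight_exists:
  fixes g :: "real \<Rightarrow> real"
  assumes int: "g integrable_on {0..T}" and nonneg: "\<And>t. t \<in> {0..T} \<Longrightarrow> 0 \<le> g t"
  shows "\<exists>w. growth_weight T g w"
proof -
  define G where "G t = integral {0..t} g" for t
  \<comment> \<open>With the integral evaluated exactly, exp (2 * G) would do; the 4 leaves slack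
    for the crude estimate \<open>local_bound\<close>.\<close>
  define w where "w t = exp (4 * G t)" for t
  have contG: "continuous_on {0..T} G"
    unfolding G_def by (rule indefinite_integral_continuous_1[OF int])
  have intsub: "g integrable_on {a..b}" if "0 \<le> a" "b \<le> T" for a b
    using integrable_subinterval_real[OF int] that by auto
  have Gdiff: "G b = G a + integral {a..b} g" if "0 \<le> a" "a \<le> b" "b \<le> T" for a b
    unfolding G_def using Henstock_Kurzweil_Integration.integral_combine[OF that(1,2)] intsub[of 0 b] that
    by (metis order_refl)
  have G_mono: "G a \<le> G b" if "0 \<le> a" "a \<le> b" "b \<le> T" for a b
    using Gdiff[OF that] integral_nonneg[OF intsub] nonneg that by force
  have G0: "G 0 = 0"
    by (simp add: G_def)
  have wcont: "continuous_on {0..T} w"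
    unfolding w_def by (intro continuous_intros contG)
  have w_mono: "w a \<le> w b" if "0 \<le> a" "a \<le> b" "b \<le> T" for a b
    using G_mono[OF that] by (simp add: w_def)
  have gabs: "g absolutely_integrable_on {0..T}"
    by (rule nonnegative_absolutely_integrable_1[OF int nonneg])
  have "(\<lambda>s. w s * g s) absolutely_integrable_on {0..T}"
  proof (rule absolutely_integrable_bounded_measurable_product_real)
    show "w \<in> borel_measurable (lebesgue_on {0..T})"
      by (rule continuous_imp_measurable_on_sets_lebesgue[OF wcont]) simp
    show "bounded (w ` {0..T})"
      by (intro compact_imp_bounded compact_continuous_image wcont compact_Icc)
  qed (use gabs in auto)
  then have gw: "(\<lambda>s. g s * w s) integrable_on {0..T}"
    by (simp add: mult.commute set_lebesgue_integral_eq_integral)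
  have gwsub: "(\<lambda>s. g s * w s) integrable_on {a..b}" if "0 \<le> a" "b \<le> T" for a b
    using integrable_subinterval_real[OF gw] that by auto
  have local_bound: "integral {a..b} (\<lambda>s. g s * w s) \<le> w b * (G b - G a)"
    if "0 \<le> a" "a \<le> b" "b \<le> T" for a b
  proof -
    have "integral {a..b} (\<lambda>s. g s * w s) \<le> integral {a..b} (\<lambda>s. g s * w b)"
      using that by (intro integral_le gwsub integrable_on_mult_left intsub)
        (auto intro!: mult_left_mono nonneg w_mono)
    also have "\<dots> = w b * (G b - G a)"
      using Gdiff[OF that] by simp
    finally show ?thesis .
  qed
  \<comment> \<open>As g is only integrable, w is not differentiated. The interval is cut where 4 *
    G passes an integer, which continuity of G allows, and on each piece w is replaced by its final
    value.\<close>
  have main: "t \<in> {0..T} \<Longrightarrow> 4 * G t \<le> real k \<Longrightarrow> integral {0..t} (\<lambda>s. g s * w s) \<le> w t / 2" for k t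
  proof (induction k arbitrary: t)
    case 0
    then show ?case
      using local_bound[of 0 t] G_mono[of 0 t] G0 by (auto simp: w_def)
  next
    case (Suc k)
    show ?case
    proof (cases "4 * G t \<le> real k")
      case True
      then show ?thesis using Suc by auto
    next
      case False
      have "\<exists>s. 0 \<le> s \<and> s \<le> t \<and> G s = k / 4"
        using Suc.prems False
        by (intro IVT') (auto simp: G0 intro: continuous_on_subset[OF contG])
      then obtain s where s: "0 \<le> s" "s \<le> t" "G s = k / 4" by auto
      define u where "u = 4 * (G t - G s)"
      have u: "0 \<le> u" "u \<le> 1"
        using Suc.prems s G_mono[of s t] by (auto simp: u_def)
      have "w s * (1 + u) \<le> w s * exp u"
        by (intro mult_left_mono exp_ge_add_one_self) (simp add: w_def)
      also have "\<dots> = w t"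
        by (simp add: w_def u_def exp_add[symmetric] algebra_simps)
      finally have ws: "w s * (1 + u) \<le> w t" .
      \<comment> \<open>(1 - u/2) * (1 + u) = 1 + u * (1 - u) / 2 is at least 1 for u in [0, 1]. So
        the integral up to s costs at most (w t / 2) * (1 - u/2), and the last piece, at most w t *
        u / 4, fills exactly the remaining gap.\<close>
      have "w t * 1 \<le> w t * ((1 - u / 2) * (1 + u))"
        using u mult_left_mono[of u 1 u] by (intro mult_left_mono) (auto simp: w_def algebra_simps)
      then have "w s * (1 + u) \<le> (w t * (1 - u / 2)) * (1 + u)"
        using ws by (simp add: mult.assoc)
      then have "w s \<le> w t * (1 - u / 2)"
        using u by (simp add: mult_le_cancel_right)
      moreover have "integral {0..t} (\<lambda>s. g s * w s)
          = integral {0..s} (\<lambda>s. g s * w s) + integral {s..t} (\<lambda>s. g s * w s)"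
        using s Suc.prems by (intro Henstock_Kurzweil_Integration.integral_combine[symmetric] gwsub) auto
      moreover have "integral {0..s} (\<lambda>s. g s * w s) \<le> w s / 2"
        using Suc s by auto
      moreover have "integral {s..t} (\<lambda>s. g s * w s) \<le> w t * (u / 4)"
        using local_bound[of s t] s(1,2) Suc.prems by (simp add: u_def right_diff_distrib)
      ultimately show ?thesis
        by (simp add: algebra_simps)
    qed
  qed
  have "growth_weight T g w"
    unfolding growth_weight_def
  proof (intro conjI ballI)
    show "mono_on {0..T} w"
      by (auto intro!: mono_onI w_mono)
    show "1 \<le> w t" if "t \<in> {0..T}" for t
      using G_mono[of 0 t] that by (auto simp: w_def G0)
    show "integral {0..t} (\<lambda>s. g s * w s) \<le> w t / 2" if "t \<in> {0..T}" for t
      using main[OF that, of "nat \<lceil>4 * G t\<rceil>"] by (metis of_nat_ceiling)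
  qed (rule gw)
  then show ?thesis by blast
qed

lemma geometric_increments:
  fixes a :: "nat \<Rightarrow> real"
  assumes "\<And>n. \<bar>a (Suc n) - a n\<bar> \<le> C * (1/2) ^ n"
  shows "\<bar>a n - lim a\<bar> \<le> 2 * C * (1/2) ^ n"
proof -
  \<comment> \<open>The factor 1 - (1/2) ^ k keeps the exact partial sum of the geometric series, so
    that the induction on k closes.\<close>
  have tail: "\<bar>a (n + k) - a n\<bar> \<le> 2 * C * (1/2) ^ n * (1 - (1/2) ^ k)" for n k
  proof (induction k)
    case (Suc k)
    have "\<bar>a (n + Suc k) - a n\<bar> \<le> \<bar>a (n + k) - a n\<bar> + C * (1/2) ^ (n + k)"
      using assms[of "n + k"] by simp
    with Suc show ?case
      by (simp add: power_add algebra_simps)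
  qed simp
  have C: "0 \<le> C" using assms[of 0] by simp
  have tail': "\<bar>a m - a n\<bar> \<le> 2 * C * (1/2) ^ n" if "n \<le> m" for m n
  proof -
    have "2 * C * (1/2) ^ n * (1 - (1/2) ^ (m - n)) \<le> 2 * C * (1/2) ^ n * 1"
      using C by (intro mult_left_mono) auto
    then show ?thesis using tail[of n "m - n"] that by simp
  qed
  have "(\<lambda>n. 2 * C * (1/2) ^ n) \<longlonglongrightarrow> 2 * C * 0"
    by (intro tendsto_intros LIMSEQ_realpow_zero) auto
  then have small: "\<exists>N. 2 * C * (1/2) ^ N < e" if "e > 0" for e
    using that order_tendstoD(2) eventually_sequentially by fastforce
  have "Cauchy a"
  proof (rule CauchyI')
    fix e :: real assume "e > 0"
    with small[of "e"] obtain N where N: "2 * C * (1/2) ^ N < e" by auto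
    have "dist (a m) (a n) < e" if "N \<le> m" "m < n" for m n
    proof -
      have "2 * C * (1/2) ^ m \<le> 2 * C * (1/2) ^ N"
        using C that by (intro mult_left_mono power_decreasing) auto
      then show ?thesis
        using tail'[of m n] that N by (simp add: dist_real_def abs_minus_commute)
    qed
    then show "\<exists>M. \<forall>m\<ge>M. \<forall>n>m. dist (a m) (a n) < e" by blast
  qed
  then have "(\<lambda>m. \<bar>a n - a m\<bar>) \<longlonglongrightarrow> \<bar>a n - lim a\<bar>"
    by (intro tendsto_intros) (simp add: Cauchy_convergent_iff convergent_LIMSEQ_iff)
  then show ?thesis
    by (rule LIMSEQ_le_const2) (use tail' in \<open>subst abs_minus_commute, blast\<close>)
qed

lemma geometric_bound_tendsto:
  fixes a :: "nat \<Rightarrow> real"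
  assumes "\<And>n. \<bar>a n - l\<bar> \<le> c * (1/2) ^ n"
  shows "a \<longlonglongrightarrow> l"
proof -
  have "(\<lambda>n. c * (1/2) ^ n) \<longlonglongrightarrow> c * 0"
    by (intro tendsto_intros LIMSEQ_realpow_zero) auto
  then have "(\<lambda>n. c * (1/2) ^ n) \<longlonglongrightarrow> 0"
    by simp
  moreover have "\<forall>\<^sub>F n in sequentially. norm (a n - l) \<le> c * (1/2) ^ n"
    by (intro always_eventually allI) (simp only: real_norm_def assms)
  ultimately have "(\<lambda>n. a n - l) \<longlonglongrightarrow> 0"
    by (rule Lim_null_comparison[rotated])
  then show ?thesis by (rule LIM_zero_cancel)
qed

lemma integral_increment:
  fixes f :: "real \<Rightarrow> real"
  assumes "f integrable_on {0..T}" "0 \<le> s" "s \<le> t" "t \<le> T"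
  shows "integral {0..t} f - integral {0..s} f = integral {s..t} f"
proof -
  have "f integrable_on {0..t}"
    using assms by (auto intro: integrable_subinterval_real)
  from Henstock_Kurzweil_Integration.integral_combine[OF assms(2,3) this] show ?thesis by simp
qed

lemma integral_abs_le:
  fixes f g :: "real \<Rightarrow> real"
  assumes "f integrable_on {0..T}" "g integrable_on {0..T}" "0 \<le> s" "t \<le> T"
    and "\<And>u. u \<in> {s..t} \<Longrightarrow> \<bar>f u\<bar> \<le> g u"
  shows "\<bar>integral {s..t} f\<bar> \<le> integral {s..t} g"
proof -
  have "f integrable_on {s..t}" "g integrable_on {s..t}"
    using assms(1-4) by (auto intro: integrable_subinterval_real)
  from integral_norm_bound_integral[OF this] show ?thesis
    using assms(5) by simp
qed

text \<open>
  Measurability is assumed only for the velocity of a density that does not depend on time.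
  Along a continuous curve it is obtained by sampling the curve at the points of a grid.
\<close>

definition sample :: "real \<Rightarrow> nat \<Rightarrow> real \<Rightarrow> real" where
  "sample T k t = min T (real (nat \<lfloor>real (Suc k) * t\<rfloor>) / real (Suc k))"

lemma sample_in:
  assumes "0 \<le> T"
  shows "sample T k t \<in> {0..T}"
  using assms by (auto simp: sample_def)

lemma sample_tendsto:
  assumes "t \<in> {0..T}"
  shows "(\<lambda>k. sample T k t) \<longlonglongrightarrow> t"
proof -
  have bounds: "t - 1 / real (Suc k) \<le> sample T k t" "sample T k t \<le> t" for k
  proof -
    have nn: "0 \<le> real (Suc k) * t" using assms by simp
    have fl: "real (nat \<lfloor>real (Suc k) * t\<rfloor>) = of_int \<lfloor>real (Suc k) * t\<rfloor>"
      using nn by (simp add: of_nat_nat)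
    have "real (Suc k) * t - 1 \<le> real (nat \<lfloor>real (Suc k) * t\<rfloor>)"
      unfolding fl by linarith
    then have "(real (Suc k) * t - 1) / real (Suc k) \<le> real (nat \<lfloor>real (Suc k) * t\<rfloor>) / real (Suc k)"
      by (rule divide_right_mono) simp
    then have "t - 1 / real (Suc k) \<le> real (nat \<lfloor>real (Suc k) * t\<rfloor>) / real (Suc k)"
      by (simp add: diff_divide_distrib)
    moreover have "t - 1 / real (Suc k) \<le> T"
      using assms by (smt (verit) atLeastAtMost_iff divide_nonneg_nonneg of_nat_0_le_iff)
    ultimately show "t - 1 / real (Suc k) \<le> sample T k t"
      by (simp add: sample_def)
    have "real (nat \<lfloor>real (Suc k) * t\<rfloor>) \<le> real (Suc k) * t"
      unfolding fl by linarith
    then show "sample T k t \<le> t"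
      unfolding sample_def by (intro min.coboundedI2) (simp add: field_simps)
  qed
  show ?thesis
  proof (rule tendsto_sandwich)
    show "(\<lambda>k. t - 1 / real (Suc k)) \<longlonglongrightarrow> t"
      using tendsto_diff[OF tendsto_const[of t] LIMSEQ_inverse_real_of_nat]
      by (simp add: inverse_eq_divide)
  qed (use bounds in auto)
qed

text \<open>The sampled time takes countably many values, so the composite is glued from countably
  many measurable maps. The map \<open>u\<close> reads off the time from a point of X, which may
  also carry space variables.\<close>

lemma sample_measurable:
  assumes T: "0 \<le> T" and f: "\<And>s. s \<in> {0..T} \<Longrightarrow> f s \<in> X \<rightarrow>\<^sub>M Y" and u: "u \<in> borel_measurable X"
  shows "(\<lambda>z. f (sample T k (u z)) z) \<in> X \<rightarrow>\<^sub>M Y"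
proof -
  have "(\<lambda>z. nat \<lfloor>real (Suc k) * u z\<rfloor>) \<in> X \<rightarrow>\<^sub>M count_space UNIV"
    using u by measurable
  moreover have "f (min T (real i / real (Suc k))) \<in> X \<rightarrow>\<^sub>M Y" for i
    using T by (intro f) auto
  ultimately show ?thesis
    unfolding sample_def by (rule measurable_compose_countable[rotated])
qed

text \<open>Merges the two alternative velocity bounds into one. A finite integral makes H finite
  off a null set, which leaves S, and B is H + 1 there, or C + 1 in the uniform case: (a + 1)^2
  dominates a, and B \<ge> 1 later lets terms without a velocity factor be absorbed into B.\<close>

lemma finite_rate_exists:
  fixes H :: "real \<Rightarrow> ennreal"
  assumes H: "(H \<in> borel_measurable (lebesgue_on {0..T}) \<and> (\<integral>\<^sup>+ t \<in> {0..T}. H t \<partial>lebesgue) \<le> ennreal C)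
    \<or> (SUP t\<in>{0..T}. H t) \<le> ennreal C"
    and C: "0 \<le> C"
  obtains S B where "S \<in> sets lebesgue" "S \<subseteq> {0..T}" "negligible ({0..T} - S)"
    "B integrable_on {0..T}" "\<And>t. t \<in> {0..T} \<Longrightarrow> (1::real) \<le> B t"
    "\<And>t. t \<in> S \<Longrightarrow> H t \<le> ennreal ((B t)\<^sup>2)"
proof -
  have sq: "ennreal a \<le> ennreal ((a + 1)\<^sup>2)" if "0 \<le> a" for a
    using that by (intro ennreal_leI) (simp add: power2_sum)
  from H show thesis
  proof
    assume A: "H \<in> borel_measurable (lebesgue_on {0..T}) \<and> (\<integral>\<^sup>+ t \<in> {0..T}. H t \<partial>lebesgue) \<le> ennreal C"
    then have [measurable]: "H \<in> borel_measurable (lebesgue_on {0..T})" by blast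
    have fin: "(\<integral>\<^sup>+ t. H t \<partial>lebesgue_on {0..T}) < \<infinity>"
      using A by (subst nn_integral_restrict_space) (auto intro: le_less_trans)
    let ?S = "{t \<in> {0..T}. H t \<noteq> \<infinity>}"
    have "{t \<in> space (lebesgue_on {0..T}). H t \<noteq> \<infinity>} \<in> sets (lebesgue_on {0..T})"
      by measurable
    then have S: "?S \<in> sets lebesgue"
      by (simp add: sets_restrict_space_iff)
    have "emeasure (lebesgue_on {0..T}) (H -` {\<infinity>} \<inter> space (lebesgue_on {0..T})) = 0"
      using fin by (intro nn_integral_PInf) auto
    moreover have "H -` {\<infinity>} \<inter> space (lebesgue_on {0..T}) = {0..T} - ?S"
      by auto
    ultimately have null: "emeasure lebesgue ({0..T} - ?S) = 0"
      by (simp add: emeasure_restrict_space)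
    have neg: "negligible ({0..T} - ?S)"
      unfolding negligible_iff_null_sets by (rule null_setsI[OF null sets.Diff[OF _ S]]) simp
    have "integrable (lebesgue_on {0..T}) (\<lambda>t. enn2real (H t))"
    proof (rule integrableI_bounded)
      have "(\<integral>\<^sup>+ t. ennreal (norm (enn2real (H t))) \<partial>lebesgue_on {0..T}) \<le> (\<integral>\<^sup>+ t. H t \<partial>lebesgue_on {0..T})"
        by (intro nn_integral_mono) (metis abs_of_nonneg enn2real_nonneg ennreal_enn2real_if order_refl real_norm_def top_greatest)
      then show "(\<integral>\<^sup>+ t. ennreal (norm (enn2real (H t))) \<partial>lebesgue_on {0..T}) < \<infinity>"
        using fin by (rule le_less_trans)
    qed measurable
    then have "(\<lambda>t. enn2real (H t)) absolutely_integrable_on {0..T}"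
      by (simp add: integrable_restrict_space set_integrable_def)
    then have "(\<lambda>t. enn2real (H t) + 1) integrable_on {0..T}"
      by (intro integrable_add integrable_const_ivl set_lebesgue_integral_eq_integral(1))
    moreover have "H t \<le> ennreal ((enn2real (H t) + 1)\<^sup>2)" if "t \<in> ?S" for t
      using sq[of "enn2real (H t)"] that by (simp add: ennreal_enn2real_if)
    ultimately show thesis
      by (intro that[OF S _ neg, of "\<lambda>t. enn2real (H t) + 1"]) auto
  next
    assume A: "(SUP t\<in>{0..T}. H t) \<le> ennreal C"
    have "H t \<le> ennreal ((C + 1)\<^sup>2)" if "t \<in> {0..T}" for t
      using SUP_upper[of t "{0..T}" H] that A sq[OF C] by (meson order_trans)
    then show thesis
      using C by (intro that[of "{0..T}" "\<lambda>_. C + 1"]) (auto simp: integrable_const_ivl)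
  qed
qed

section \<open>The flux in the weighted supremum norm\<close>

text \<open>Positive dimension enters here: suprema over \<open>offdiag\<close> and the sign of
  bounds valid on it are meaningful only if it has a point.\<close>

lemma offdiag_nonempty:
  "(offdiag :: ('a::euclidean_space \<times> 'a) set) \<noteq> {}"
proof -
  obtain b :: 'a where "b \<in> Basis" using nonempty_Basis by blast
  then have "(0, b) \<in> offdiag" by (auto simp: offdiag_def)
  then show ?thesis by blast
qed

lemma offdiag_borel: "(offdiag :: ('a::euclidean_space \<times> 'a) set) \<in> sets borel"
proof -
  have "offdiag = - {p :: 'a \<times> 'a. fst p = snd p}"
    by (auto simp: offdiag_def)
  moreover have "closed {p :: 'a \<times> 'a. fst p = snd p}"
    by (intro closed_Collect_eq continuous_intros)
  ultimately show ?thesis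
    by (metis borel_closed borel_comp)
qed

text \<open>The hypotheses in the form in which they are applied: suprema are replaced by
  inequalities at single points, and the alternative for the velocity by the pair S, B of
  \<open>finite_rate_exists\<close>.\<close>

locale coNCL_data = prob_space M
  for M :: "'a::euclidean_space measure" +
  fixes \<Phi> :: "real \<Rightarrow> real \<Rightarrow> real \<Rightarrow> real"
    and V \<omega> :: "real \<Rightarrow> ('a \<Rightarrow> real) \<Rightarrow> 'a \<times> 'a \<Rightarrow> real"
    and T L LV L\<omega> C\<omega> E0 :: real
    and r0 :: "'a \<Rightarrow> real" and \<eta>0 :: "'a \<times> 'a \<Rightarrow> real"
    and S :: "real set" and B :: "real \<Rightarrow> real"
  assumes T_pos: "0 < T"
    and sets_M[measurable_cong]: "sets M = sets borel"
    and \<Phi>_measurable: "(\<lambda>(a, b, v). \<Phi> a b v) \<in> borel_measurable borel"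
    and \<Phi>_zero: "\<Phi> a b 0 = 0"
    and L_nonneg: "0 \<le> L"
    and \<Phi>_Lipschitz_velocity: "\<bar>\<Phi> a b w - \<Phi> a b v\<bar> \<le> L * (\<bar>a\<bar> + \<bar>b\<bar>) * \<bar>w - v\<bar>"
    and \<Phi>_Lipschitz_density: "\<bar>\<Phi> a b v - \<Phi> c d v\<bar> \<le> L * (\<bar>a - c\<bar> + \<bar>b - d\<bar>) * \<bar>v\<bar>"
    and r0_L2: "r0 \<in> L2 M"
    and \<eta>0_continuous: "continuous_on offdiag \<eta>0"
    and \<eta>0_bound: "p \<in> offdiag \<Longrightarrow> \<bar>\<eta>0 p\<bar> \<le> E0"
    and E0_nonneg: "0 \<le> E0"
    and V_measurable: "g \<in> L2 M \<Longrightarrow>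
      (\<lambda>(t, p). V t g p) \<in> borel_measurable (lebesgue_on {0..T} \<Otimes>\<^sub>M restrict_space borel offdiag)"
    and V_bound: "t \<in> S \<Longrightarrow> g \<in> L2 M \<Longrightarrow>
      (\<integral>\<^sup>+ y \<in> UNIV - {x}. ennreal (\<bar>V t g (x, y)\<bar>\<^sup>2) \<partial>M) \<le> ennreal ((B t)\<^sup>2)"
    and LV_nonneg: "0 \<le> LV"
    and V_Lipschitz: "t \<in> {0..T} \<Longrightarrow> g \<in> L2 M \<Longrightarrow> g' \<in> L2 M \<Longrightarrow>
      (\<integral>\<^sup>+ y \<in> UNIV - {x}. ennreal (\<bar>V t g (x, y) - V t g' (x, y)\<bar>\<^sup>2) \<partial>M)
        \<le> ennreal (LV * (L2_norm M (\<lambda>x. g x - g' x))\<^sup>2)"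
    and S_measurable: "S \<in> sets lebesgue" and S_subset: "S \<subseteq> {0..T}"
    and S_full: "negligible ({0..T} - S)"
    and B_integrable: "B integrable_on {0..T}"
    and B_ge_1: "t \<in> {0..T} \<Longrightarrow> 1 \<le> B t"
    and \<omega>_continuous: "t \<in> {0..T} \<Longrightarrow> g \<in> L2 M \<Longrightarrow> continuous_on offdiag (\<omega> t g)"
    and \<omega>_measurable: "g \<in> L2 M \<Longrightarrow> p \<in> offdiag \<Longrightarrow>
      (\<lambda>t. \<omega> t g p) \<in> borel_measurable (lebesgue_on {0..T})"
    and L\<omega>_nonneg: "0 \<le> L\<omega>"
    and \<omega>_Lipschitz: "t \<in> {0..T} \<Longrightarrow> g \<in> L2 M \<Longrightarrow> g' \<in> L2 M \<Longrightarrow> p \<in> offdiag \<Longrightarrow>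
      \<bar>\<omega> t g p - \<omega> t g' p\<bar> \<le> L\<omega> * L2_norm M (\<lambda>x. g x - g' x)"
    and C\<omega>_nonneg: "0 \<le> C\<omega>"
    and \<omega>_bound: "t \<in> {0..T} \<Longrightarrow> g \<in> L2 M \<Longrightarrow> p \<in> offdiag \<Longrightarrow> \<bar>\<omega> t g p\<bar> \<le> C\<omega>"
begin

section \<open>The weight \<alpha> and the weighted Cauchy-Schwarz inequality\<close>

definition \<alpha> :: "'a \<Rightarrow> real" where
  "\<alpha> x = \<bar>r0 x\<bar> + 1"

definition N :: real where
  "N = L2_norm M \<alpha>"

text \<open>\<open>P * \<alpha> x\<close> bounds the L2 norm of the map sending y to \<alpha> x +
  \<alpha> y: its square is at most 2 * (\<alpha> x)^2 + 2 * N^2, and N^2 is at most N^2 * (\<alpha>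
  x)^2.\<close>

definition P :: real where
  "P = sqrt (2 * (1 + N\<^sup>2))"

lemma \<alpha>_ge_1: "1 \<le> \<alpha> x"
  by (simp add: \<alpha>_def)

lemma \<alpha>_nonneg: "0 \<le> \<alpha> x"
  by (simp add: \<alpha>_def)

lemma N_nonneg: "0 \<le> N" and P_nonneg: "0 \<le> P"
  by (auto simp: N_def L2_norm_def P_def)

lemma r0_measurable[measurable]: "r0 \<in> borel_measurable M"
  using r0_L2 by (simp add: L2_def)

lemma \<alpha>_measurable[measurable]: "\<alpha> \<in> borel_measurable M"
  unfolding \<alpha>_def by measurable

lemma \<alpha>_sq_integrable: "integrable M (\<lambda>x. (\<alpha> x)\<^sup>2)"
proof (rule Bochner_Integration.integrable_bound)
  show "integrable M (\<lambda>x. 2 * (r0 x)\<^sup>2 + 2)"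
    using r0_L2 by (auto simp: L2_def)
  have "(\<bar>a\<bar> + 1)\<^sup>2 \<le> 2 * a\<^sup>2 + 2" for a :: real
    using sum_squares_bound[of "\<bar>a\<bar>" 1] by (simp add: power2_sum)
  then show "AE x in M. norm ((\<alpha> x)\<^sup>2) \<le> norm (2 * (r0 x)\<^sup>2 + 2)"
    by (auto simp: \<alpha>_def)
qed simp

lemma N_sq: "N\<^sup>2 = (\<integral>x. (\<alpha> x)\<^sup>2 \<partial>M)"
  by (simp add: N_def L2_norm_def)

text \<open>The bridge from estimates at every x to the hypotheses on V and \<omega>, which measure
  densities in the L2 norm.\<close>

lemma dominated_L2:
  assumes [measurable]: "g \<in> borel_measurable M" and le: "\<And>x. \<bar>g x\<bar> \<le> c * \<alpha> x"
  shows "g \<in> L2 M" and "L2_norm M g \<le> c * N"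
proof -
  \<comment> \<open>Any single point gives the sign of c, since \<alpha> is positive.\<close>
  have c: "0 \<le> c"
    using le[of undefined] \<alpha>_ge_1[of undefined] by (smt (verit) mult_neg_pos)
  have sq: "(g x)\<^sup>2 \<le> c\<^sup>2 * (\<alpha> x)\<^sup>2" for x
    using power_mono[OF le[of x], of 2] by (simp add: power_mult_distrib)
  have int: "integrable M (\<lambda>x. (g x)\<^sup>2)"
    by (rule Bochner_Integration.integrable_bound[where f="\<lambda>x. c\<^sup>2 * (\<alpha> x)\<^sup>2"])
      (use sq \<alpha>_sq_integrable in auto)
  then show "g \<in> L2 M" by (simp add: L2_def)
  have "(\<integral>x. (g x)\<^sup>2 \<partial>M) \<le> (\<integral>x. c\<^sup>2 * (\<alpha> x)\<^sup>2 \<partial>M)"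
    by (rule integral_mono) (use int \<alpha>_sq_integrable sq in auto)
  also have "\<dots> = (c * N)\<^sup>2"
    by (simp add: N_sq power_mult_distrib)
  finally show "L2_norm M g \<le> c * N"
    unfolding L2_norm_def using c N_nonneg by (intro real_le_lsqrt) auto
qed

text \<open>The factor \<alpha> x + \<alpha> y is what the growth bound |a| + |b| of the flux
  becomes for densities dominated by \<alpha>. Working with extended nonnegative integrals makes
  integrability a conclusion.\<close>

lemma weighted_Cauchy_Schwarz:
  assumes [measurable]: "v \<in> borel_measurable M"
    and v: "(\<integral>\<^sup>+ y. ennreal ((v y)\<^sup>2) \<partial>M) \<le> ennreal (b\<^sup>2)" and b: "0 \<le> b"
  shows "integrable M (\<lambda>y. (\<alpha> x + \<alpha> y) * \<bar>v y\<bar>)"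
    and "(\<integral>y. (\<alpha> x + \<alpha> y) * \<bar>v y\<bar> \<partial>M) \<le> P * \<alpha> x * b"
proof -
  let ?I = "\<integral>\<^sup>+ y. ennreal ((\<alpha> x + \<alpha> y) * \<bar>v y\<bar>) \<partial>M"
  have weight: "(\<integral>\<^sup>+ y. ennreal ((\<alpha> x + \<alpha> y)\<^sup>2) \<partial>M) \<le> ennreal ((P * \<alpha> x)\<^sup>2)"
  proof -
    have "(\<integral>\<^sup>+ y. ennreal ((\<alpha> x + \<alpha> y)\<^sup>2) \<partial>M) \<le> (\<integral>\<^sup>+ y. ennreal (2 * (\<alpha> x)\<^sup>2 + 2 * (\<alpha> y)\<^sup>2) \<partial>M)"
    proof (rule nn_integral_mono)
      fix y
      show "ennreal ((\<alpha> x + \<alpha> y)\<^sup>2) \<le> ennreal (2 * (\<alpha> x)\<^sup>2 + 2 * (\<alpha> y)\<^sup>2)"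
        using sum_squares_bound[of "\<alpha> x" "\<alpha> y"] by (intro ennreal_leI) (simp add: power2_sum)
    qed
    also have "\<dots> = ennreal (\<integral>y. 2 * (\<alpha> x)\<^sup>2 + 2 * (\<alpha> y)\<^sup>2 \<partial>M)"
      using \<alpha>_sq_integrable by (intro nn_integral_eq_integral) auto
    also have "(\<integral>y. 2 * (\<alpha> x)\<^sup>2 + 2 * (\<alpha> y)\<^sup>2 \<partial>M) = 2 * (\<alpha> x)\<^sup>2 + 2 * N\<^sup>2"
      using \<alpha>_sq_integrable by (simp add: N_sq prob_space)
    also have "ennreal \<dots> \<le> ennreal ((P * \<alpha> x)\<^sup>2)"
    proof (rule ennreal_leI)
      have "N\<^sup>2 * 1 \<le> N\<^sup>2 * (\<alpha> x)\<^sup>2"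
        using \<alpha>_ge_1[of x] by (intro mult_left_mono) auto
      then show "2 * (\<alpha> x)\<^sup>2 + 2 * N\<^sup>2 \<le> (P * \<alpha> x)\<^sup>2"
        by (simp add: P_def power_mult_distrib algebra_simps)
    qed
    finally show ?thesis .
  qed
  have "?I\<^sup>2 = (\<integral>\<^sup>+ y. ennreal (\<alpha> x + \<alpha> y) * ennreal \<bar>v y\<bar> \<partial>M)\<^sup>2"
    using \<alpha>_nonneg by (simp add: ennreal_mult)
  also have "\<dots> \<le> (\<integral>\<^sup>+ y. (ennreal (\<alpha> x + \<alpha> y))\<^sup>2 \<partial>M) * (\<integral>\<^sup>+ y. (ennreal \<bar>v y\<bar>)\<^sup>2 \<partial>M)"
    by (rule Cauchy_Schwarz_nn_integral) measurable
  also have "\<dots> = (\<integral>\<^sup>+ y. ennreal ((\<alpha> x + \<alpha> y)\<^sup>2) \<partial>M) * (\<integral>\<^sup>+ y. ennreal ((v y)\<^sup>2) \<partial>M)"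
    using \<alpha>_nonneg by (simp add: ennreal_power del: ennreal_plus)
  also have "\<dots> \<le> ennreal ((P * \<alpha> x)\<^sup>2) * ennreal (b\<^sup>2)"
    by (intro mult_mono weight v) auto
  also have "\<dots> = ennreal ((P * \<alpha> x * b)\<^sup>2)"
    by (simp add: ennreal_mult power_mult_distrib)
  finally have sq: "?I\<^sup>2 \<le> ennreal ((P * \<alpha> x * b)\<^sup>2)" .
  have nn: "0 \<le> P * \<alpha> x * b"
    using P_nonneg \<alpha>_nonneg b by simp
  have le: "?I \<le> ennreal (P * \<alpha> x * b)"
  \<comment> \<open>The root is taken by cases: an infinite integral would have an infinite square,
    contrary to \<open>sq\<close>.\<close>
  proof (cases ?I)
    case (real i)
    then have "i\<^sup>2 \<le> (P * \<alpha> x * b)\<^sup>2"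
      using sq by (simp add: ennreal_power)
    then have "i \<le> P * \<alpha> x * b"
      using nn by (rule power2_le_imp_le)
    then show ?thesis
      unfolding real by (rule ennreal_leI)
  next
    case top
    then show ?thesis using sq by (simp add: ennreal_top_eq_mult_iff top_unique power2_eq_square)
  qed
  show int: "integrable M (\<lambda>y. (\<alpha> x + \<alpha> y) * \<bar>v y\<bar>)"
    by (rule integrableI_bounded)
      (use le \<alpha>_nonneg in \<open>auto simp: abs_mult intro: le_less_trans\<close>)
  have "ennreal (\<integral>y. (\<alpha> x + \<alpha> y) * \<bar>v y\<bar> \<partial>M) = ?I"
    using int \<alpha>_nonneg by (intro nn_integral_eq_integral[symmetric]) auto
  with le nn show "(\<integral>y. (\<alpha> x + \<alpha> y) * \<bar>v y\<bar> \<partial>M) \<le> P * \<alpha> x * b"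
    by (metis ennreal_le_iff)
qed

section \<open>The flux of a fixed bounded state\<close>

definition bounded_state :: "real \<Rightarrow> real \<Rightarrow> ('a \<Rightarrow> real) \<Rightarrow> ('a \<times> 'a \<Rightarrow> real) \<Rightarrow> bool" where
  "bounded_state R E g h \<longleftrightarrow>
     g \<in> borel_measurable M \<and> (\<forall>x. \<bar>g x\<bar> \<le> R * \<alpha> x) \<and>
     continuous_on offdiag h \<and> (\<forall>p\<in>offdiag. \<bar>h p\<bar> \<le> E)"

text \<open>Extension by 0 to the diagonal turns integrals over the complement of x into integrals
  over the whole space. The value on the diagonal matters, since the measure may have atoms.\<close>

definition velocity :: "real \<Rightarrow> ('a \<Rightarrow> real) \<Rightarrow> 'a \<Rightarrow> 'a \<Rightarrow> real" where
  "velocity t g x y = (if y = x then 0 else V t g (x, y))"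

definition weight_off_diag :: "('a \<times> 'a \<Rightarrow> real) \<Rightarrow> 'a \<Rightarrow> 'a \<Rightarrow> real" where
  "weight_off_diag h x y = (if y = x then 0 else h (x, y))"

definition flux_density :: "real \<Rightarrow> ('a \<Rightarrow> real) \<Rightarrow> ('a \<times> 'a \<Rightarrow> real) \<Rightarrow> 'a \<Rightarrow> 'a \<Rightarrow> real" where
  "flux_density t g h x y = \<Phi> (g x) (g y) (velocity t g x y) * weight_off_diag h x y"

lemma velocity_measurable:
  assumes "g \<in> L2 M"
  shows "(\<lambda>(t, x, y). velocity t g x y) \<in> borel_measurable (lebesgue_on {0..T} \<Otimes>\<^sub>M (borel \<Otimes>\<^sub>M borel))"
proof -
  have [measurable]: "Measurable.pred (borel \<Otimes>\<^sub>M borel) (\<lambda>p :: 'a \<times> 'a. p \<in> offdiag)"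
    unfolding borel_prod by (simp add: pred_def offdiag_borel)
  let ?X = "lebesgue_on {0..T} \<Otimes>\<^sub>M (borel \<Otimes>\<^sub>M (borel :: 'a measure))"
  have "(\<lambda>z. if snd z \<in> offdiag then V (fst z) g (snd z) else 0) \<in> borel_measurable ?X"
  proof (subst measurable_If_restrict_space_iff, measurable, intro conjI)
    let ?Y = "restrict_space ?X {z. snd z \<in> offdiag}"
    have "(\<lambda>z. (fst z, snd z)) \<in> ?Y \<rightarrow>\<^sub>M lebesgue_on {0..T} \<Otimes>\<^sub>M restrict_space borel offdiag"
    proof (rule measurable_Pair)
      show "fst \<in> ?Y \<rightarrow>\<^sub>M lebesgue_on {0..T}"
        by (rule measurable_restrict_space1) measurable
      show "snd \<in> ?Y \<rightarrow>\<^sub>M restrict_space borel offdiag"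
        by (rule measurable_restrict_space2)
          (auto simp: space_restrict_space borel_prod[symmetric] intro: measurable_restrict_space1)
    qed
    from measurable_compose[OF this V_measurable[OF assms]]
    show "(\<lambda>z. V (fst z) g (snd z)) \<in> borel_measurable ?Y"
      by (simp add: case_prod_beta')
  qed simp
  moreover have "(\<lambda>z. if snd z \<in> offdiag then V (fst z) g (snd z) else 0)
      = (\<lambda>(t, x, y). velocity t g x y)"
    by (auto simp: velocity_def offdiag_def fun_eq_iff)
  ultimately show ?thesis by simp
qed

lemma weight_off_diag_measurable:
  assumes "continuous_on offdiag h"
  shows "(\<lambda>(x, y). weight_off_diag h x y) \<in> borel_measurable (borel \<Otimes>\<^sub>M borel)"
proof -
  have "(\<lambda>p. if p \<in> offdiag then h p else 0) \<in> borel_measurable borel"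
    by (rule borel_measurable_continuous_on_if[OF offdiag_borel assms]) simp
  moreover have "(\<lambda>p. if p \<in> offdiag then h p else 0) = (\<lambda>(x, y). weight_off_diag h x y)"
    by (auto simp: weight_off_diag_def offdiag_def fun_eq_iff)
  ultimately show ?thesis
    by (simp add: borel_prod)
qed

lemma \<Phi>_compose_measurable[measurable (raw)]:
  assumes [measurable]: "a \<in> borel_measurable X" "b \<in> borel_measurable X" "v \<in> borel_measurable X"
  shows "(\<lambda>z. \<Phi> (a z) (b z) (v z)) \<in> borel_measurable X"
proof -
  have "(\<lambda>z. (a z, b z, v z)) \<in> borel_measurable X" by measurable
  from measurable_compose[OF this \<Phi>_measurable] show ?thesis by simp
qed

lemma velocity_section_measurable:
  assumes "g \<in> L2 M" "t \<in> {0..T}"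
  shows "velocity t g x \<in> borel_measurable M"
proof -
  have "(\<lambda>y. (t, x, y)) \<in> M \<rightarrow>\<^sub>M lebesgue_on {0..T} \<Otimes>\<^sub>M (borel \<Otimes>\<^sub>M borel)"
    using assms(2) by (intro measurable_Pair) (auto intro!: measurable_const measurable_ident_sets simp: sets_M)
  from measurable_compose[OF this velocity_measurable[OF assms(1)]] show ?thesis by simp
qed

lemma weight_section_measurable:
  assumes "continuous_on offdiag h"
  shows "weight_off_diag h x \<in> borel_measurable M"
proof -
  have "(\<lambda>y. (x, y)) \<in> M \<rightarrow>\<^sub>M borel \<Otimes>\<^sub>M borel"
    by (intro measurable_Pair) (auto intro!: measurable_ident_sets simp: sets_M)
  from measurable_compose[OF this weight_off_diag_measurable[OF assms]] show ?thesis by simp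
qed

lemma flux_integrand:
  "indicator (UNIV - {x}) y *\<^sub>R (\<Phi> (r t x) (r t y) (V t (r t) (x, y)) * \<eta> t (x, y))
    = flux_density t (r t) (\<eta> t) x y"
  by (auto simp: flux_density_def velocity_def weight_off_diag_def)

lemma flux_integral_eq:
  "flux_integral M \<Phi> V r \<eta> t x = (\<integral>y. flux_density t (r t) (\<eta> t) x y \<partial>M)"
  unfolding flux_integral_def set_lebesgue_integral_def flux_integrand ..

lemma velocity_bound:
  assumes "t \<in> S" "g \<in> L2 M"
  shows "(\<integral>\<^sup>+ y. ennreal ((velocity t g x y)\<^sup>2) \<partial>M) \<le> ennreal ((B t)\<^sup>2)"
proof -
  have "(\<integral>\<^sup>+ y. ennreal ((velocity t g x y)\<^sup>2) \<partial>M)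
      = (\<integral>\<^sup>+ y \<in> UNIV - {x}. ennreal (\<bar>V t g (x, y)\<bar>\<^sup>2) \<partial>M)"
    by (intro nn_integral_cong) (auto simp: velocity_def)
  with V_bound[OF assms] show ?thesis by simp
qed

lemma velocity_Lipschitz:
  assumes "t \<in> {0..T}" "g \<in> L2 M" "g' \<in> L2 M"
  shows "(\<integral>\<^sup>+ y. ennreal ((velocity t g x y - velocity t g' x y)\<^sup>2) \<partial>M)
    \<le> ennreal ((sqrt LV * L2_norm M (\<lambda>x. g x - g' x))\<^sup>2)"
proof -
  have "(\<integral>\<^sup>+ y. ennreal ((velocity t g x y - velocity t g' x y)\<^sup>2) \<partial>M)
      = (\<integral>\<^sup>+ y \<in> UNIV - {x}. ennreal (\<bar>V t g (x, y) - V t g' (x, y)\<bar>\<^sup>2) \<partial>M)"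
    by (intro nn_integral_cong) (auto simp: velocity_def)
  with V_Lipschitz[OF assms] show ?thesis
    using LV_nonneg by (simp add: power_mult_distrib)
qed

lemma \<Phi>_bound: "\<bar>\<Phi> a b v\<bar> \<le> L * (\<bar>a\<bar> + \<bar>b\<bar>) * \<bar>v\<bar>"
  using \<Phi>_Lipschitz_velocity[of a b v 0] by (simp add: \<Phi>_zero)

lemma flux_density_measurable:
  assumes "bounded_state R E g h" "t \<in> {0..T}"
  shows "flux_density t g h x \<in> borel_measurable M"
proof -
  have [measurable]: "g \<in> borel_measurable M" "weight_off_diag h x \<in> borel_measurable M"
    using assms weight_section_measurable by (auto simp: bounded_state_def)
  have [measurable]: "velocity t g x \<in> borel_measurable M"
    using assms by (intro velocity_section_measurable dominated_L2(1)) (auto simp: bounded_state_def)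
  show ?thesis unfolding flux_density_def by measurable
qed

lemma bounded_state_nonneg:
  assumes "bounded_state R E g h"
  shows "0 \<le> R" "0 \<le> E"
proof -
  show "0 \<le> R"
    using assms \<alpha>_ge_1[of undefined] unfolding bounded_state_def
    by (smt (verit) mult_neg_pos)
  obtain p :: "'a \<times> 'a" where "p \<in> offdiag" using offdiag_nonempty by blast
  then show "0 \<le> E"
    using assms unfolding bounded_state_def by (metis abs_ge_zero order_trans)
qed

lemma weight_off_diag_bound:
  assumes "bounded_state R E g h"
  shows "\<bar>weight_off_diag h x y\<bar> \<le> E"
  using assms bounded_state_nonneg[OF assms]
  by (auto simp: bounded_state_def weight_off_diag_def offdiag_def)

lemma state_sum_bound:
  assumes "bounded_state R E g h"
  shows "\<bar>g x\<bar> + \<bar>g y\<bar> \<le> R * (\<alpha> x + \<alpha> y)"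
proof -
  have "\<bar>g x\<bar> \<le> R * \<alpha> x" "\<bar>g y\<bar> \<le> R * \<alpha> y"
    using assms by (auto simp: bounded_state_def)
  then show ?thesis by (simp add: distrib_left)
qed

text \<open>The right-hand side is linear in R, and the velocity enters only through B t, whatever
  the density. This linearity is what yields a bound for r on all of [0, T].\<close>

lemma flux_bound:
  assumes st: "bounded_state R E g h" and t: "t \<in> S"
  shows "integrable M (flux_density t g h x)"
    and "\<bar>\<integral>y. flux_density t g h x y \<partial>M\<bar> \<le> L * E * P * R * B t * \<alpha> x"
proof -
  have tT: "t \<in> {0..T}" using t S_subset by auto
  have gL: "g \<in> L2 M"
    using st unfolding bounded_state_def by (blast intro: dominated_L2(1))
  note nn = bounded_state_nonneg[OF st]
  have Bt: "0 \<le> B t" using B_ge_1[OF tT] by simp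
  note cs = weighted_Cauchy_Schwarz[OF velocity_section_measurable[OF gL tT] velocity_bound[OF t gL] Bt, of x x]
  have le: "\<bar>flux_density t g h x y\<bar> \<le> L * R * E * ((\<alpha> x + \<alpha> y) * \<bar>velocity t g x y\<bar>)" for y
  proof -
    have "\<bar>flux_density t g h x y\<bar> \<le> (L * (R * (\<alpha> x + \<alpha> y)) * \<bar>velocity t g x y\<bar>) * E"
      unfolding flux_density_def abs_mult
      using L_nonneg nn \<alpha>_nonneg
      by (intro mult_mono order_trans[OF \<Phi>_bound] mult_right_mono mult_left_mono
          state_sum_bound[OF st] weight_off_diag_bound[OF st]) auto
    then show ?thesis by (simp add: mult_ac)
  qed
  show int: "integrable M (flux_density t g h x)"
    by (rule Bochner_Integration.integrable_bound[OF integrable_mult_right[OF cs(1), of "L * R * E"]])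
      (use le order_trans[OF le abs_ge_self] flux_density_measurable[OF st tT] in auto)
  have "\<bar>\<integral>y. flux_density t g h x y \<partial>M\<bar> \<le> (\<integral>y. \<bar>flux_density t g h x y\<bar> \<partial>M)"
    by (rule integral_abs_bound)
  also have "\<dots> \<le> (\<integral>y. L * R * E * ((\<alpha> x + \<alpha> y) * \<bar>velocity t g x y\<bar>) \<partial>M)"
    by (rule integral_mono) (use int cs(1) le in auto)
  also have "\<dots> \<le> L * R * E * (P * \<alpha> x * B t)"
    using cs(2) L_nonneg nn by (auto intro: mult_left_mono)
  finally show "\<bar>\<integral>y. flux_density t g h x y \<partial>M\<bar> \<le> L * E * P * R * B t * \<alpha> x"
    by (simp add: mult_ac)
qed

text \<open>The three summands come from changing one thing at a time: the density arguments of
  \<Phi>, the velocity through its dependence on the density, and the weight. The middle one carries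
  E * R and makes the constant depend on the size of the states beyond linear order.\<close>

definition Lipschitz_const :: "real \<Rightarrow> real \<Rightarrow> real" where
  "Lipschitz_const R E = L * P * (E + E * R * sqrt LV * N + R)"

lemma flux_Lipschitz:
  assumes st: "bounded_state R E g h" "bounded_state R E g' h'" and t: "t \<in> S"
    and g: "\<And>x. \<bar>g x - g' x\<bar> \<le> d * \<alpha> x" and h: "\<And>p. p \<in> offdiag \<Longrightarrow> \<bar>h p - h' p\<bar> \<le> d"
  shows "\<bar>(\<integral>y. flux_density t g h x y \<partial>M) - (\<integral>y. flux_density t g' h' x y \<partial>M)\<bar>
    \<le> Lipschitz_const R E * B t * d * \<alpha> x"
proof -
  have tT: "t \<in> {0..T}" using t S_subset by auto
  have gL: "g \<in> L2 M" "g' \<in> L2 M"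
    using st unfolding bounded_state_def by (blast intro: dominated_L2(1))+
  have gm[measurable]: "g \<in> borel_measurable M" "g' \<in> borel_measurable M"
    using st by (auto simp: bounded_state_def)
  note nn = bounded_state_nonneg[OF st(1)]
  have d: "0 \<le> d"
    using g[of undefined] \<alpha>_ge_1[of undefined] by (smt (verit) mult_neg_pos)
  have Bt: "1 \<le> B t" "0 \<le> B t" using B_ge_1[OF tT] by auto
  let ?v = "velocity t g x" and ?v' = "velocity t g' x"
  have vm[measurable]: "?v \<in> borel_measurable M" "?v' \<in> borel_measurable M"
    using velocity_section_measurable gL tT by auto
  \<comment> \<open>The velocity at x depends on the whole density, so closeness in the weighted
    supremum norm is passed through the L2 norm.\<close>
  have "L2_norm M (\<lambda>x. g x - g' x) \<le> d * N"
    by (rule dominated_L2(2)) (use g in auto)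
  then have dist: "(\<integral>\<^sup>+ y. ennreal ((?v y - ?v' y)\<^sup>2) \<partial>M) \<le> ennreal ((sqrt LV * (d * N))\<^sup>2)"
    using LV_nonneg by (intro order_trans[OF velocity_Lipschitz[OF tT gL]] ennreal_leI power_mono mult_left_mono)
      (auto simp: L2_norm_def)
  note cs = weighted_Cauchy_Schwarz[OF vm(1) velocity_bound[OF t gL(1)] Bt(2), of x]
  note cs' = weighted_Cauchy_Schwarz[OF vm(2) velocity_bound[OF t gL(2)] Bt(2), of x]
  have "0 \<le> sqrt LV * (d * N)" using LV_nonneg d N_nonneg by simp
  note csd = weighted_Cauchy_Schwarz[OF borel_measurable_diff[OF vm] dist this, of x]
  let ?a = "\<lambda>y. (\<alpha> x + \<alpha> y) * \<bar>?v y\<bar>" and ?a' = "\<lambda>y. (\<alpha> x + \<alpha> y) * \<bar>?v' y\<bar>"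
    and ?b = "\<lambda>y. (\<alpha> x + \<alpha> y) * \<bar>?v y - ?v' y\<bar>"
  let ?bound = "\<lambda>y. L * d * E * ?a y + L * R * E * ?b y + L * R * d * ?a' y"
  have le: "\<bar>flux_density t g h x y - flux_density t g' h' x y\<bar> \<le> ?bound y" for y
  proof -
    let ?h = "weight_off_diag h x y" and ?h' = "weight_off_diag h' x y"
    have hE: "\<bar>?h\<bar> \<le> E" and hd: "\<bar>?h - ?h'\<bar> \<le> d"
      using weight_off_diag_bound[OF st(1)] h d by (auto simp: weight_off_diag_def offdiag_def)
    have gd: "\<bar>g x - g' x\<bar> + \<bar>g y - g' y\<bar> \<le> d * (\<alpha> x + \<alpha> y)"
      using g[of x] g[of y] by (simp add: distrib_left)
    have split: "flux_density t g h x y - flux_density t g' h' x y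
        = (\<Phi> (g x) (g y) (?v y) - \<Phi> (g' x) (g' y) (?v y)) * ?h
          + (\<Phi> (g' x) (g' y) (?v y) - \<Phi> (g' x) (g' y) (?v' y)) * ?h
          + \<Phi> (g' x) (g' y) (?v' y) * (?h - ?h')"
      by (simp add: flux_density_def algebra_simps)
    have "\<bar>flux_density t g h x y - flux_density t g' h' x y\<bar>
        \<le> \<bar>\<Phi> (g x) (g y) (?v y) - \<Phi> (g' x) (g' y) (?v y)\<bar> * \<bar>?h\<bar>
          + \<bar>\<Phi> (g' x) (g' y) (?v y) - \<Phi> (g' x) (g' y) (?v' y)\<bar> * \<bar>?h\<bar>
          + \<bar>\<Phi> (g' x) (g' y) (?v' y)\<bar> * \<bar>?h - ?h'\<bar>"
      unfolding split abs_mult[symmetric] by linarith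
    also have "\<dots> \<le> (L * (d * (\<alpha> x + \<alpha> y)) * \<bar>?v y\<bar>) * E
          + (L * (R * (\<alpha> x + \<alpha> y)) * \<bar>?v y - ?v' y\<bar>) * E
          + (L * (R * (\<alpha> x + \<alpha> y)) * \<bar>?v' y\<bar>) * d"
      using L_nonneg nn \<alpha>_nonneg d
      by (intro add_mono mult_mono[OF order_trans[OF \<Phi>_Lipschitz_density] hE]
          mult_mono[OF order_trans[OF \<Phi>_Lipschitz_velocity] hE]
          mult_mono[OF order_trans[OF \<Phi>_bound] hd] mult_right_mono mult_left_mono
          state_sum_bound[OF st(2)] gd) auto
    finally show ?thesis by (simp add: mult_ac)
  qed
  have int: "integrable M (flux_density t g h x)" "integrable M (flux_density t g' h' x)"
    using flux_bound(1) st t by auto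
  have "\<bar>(\<integral>y. flux_density t g h x y \<partial>M) - (\<integral>y. flux_density t g' h' x y \<partial>M)\<bar>
      = \<bar>\<integral>y. flux_density t g h x y - flux_density t g' h' x y \<partial>M\<bar>"
    using int by simp
  also have "\<dots> \<le> (\<integral>y. \<bar>flux_density t g h x y - flux_density t g' h' x y\<bar> \<partial>M)"
    by (rule integral_abs_bound)
  also have "\<dots> \<le> (\<integral>y. ?bound y \<partial>M)"
    by (rule integral_mono) (use int cs(1) cs'(1) csd(1) le in auto)
  also have "\<dots> = L * d * E * (\<integral>y. ?a y \<partial>M) + L * R * E * (\<integral>y. ?b y \<partial>M) + L * R * d * (\<integral>y. ?a' y \<partial>M)"
    using cs(1) cs'(1) csd(1) by simp
  also have "\<dots> \<le> L * d * E * (P * \<alpha> x * B t) + L * R * E * (P * \<alpha> x * (sqrt LV * (d * N)))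
      + L * R * d * (P * \<alpha> x * B t)"
    using cs(2) cs'(2) csd(2) L_nonneg nn d by (intro add_mono mult_left_mono) auto
  \<comment> \<open>The term from the velocity difference has no factor B t; B t \<ge> 1 supplies
    one, so that all three terms share it.\<close>
  also have "\<dots> \<le> L * d * E * (P * \<alpha> x * B t) + L * R * E * (P * \<alpha> x * (sqrt LV * (d * N))) * B t
      + L * R * d * (P * \<alpha> x * B t)"
  proof -
    have "0 \<le> L * R * E * (P * \<alpha> x * (sqrt LV * (d * N)))"
      using L_nonneg nn d P_nonneg N_nonneg LV_nonneg \<alpha>_nonneg by simp
    from mult_left_mono[OF Bt(1) this] show ?thesis by simp
  qed
  also have "\<dots> = Lipschitz_const R E * B t * d * \<alpha> x"
    by (simp add: Lipschitz_const_def algebra_simps)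
  finally show ?thesis .
qed

section \<open>Measurability of the flux along continuous curves\<close>

text \<open>
  At times outside \<open>S\<close> the velocity need not be square integrable and the flux integral may
  be a junk value.
\<close>

definition cut_flux :: "(real \<Rightarrow> 'a \<Rightarrow> real) \<Rightarrow> (real \<Rightarrow> 'a \<times> 'a \<Rightarrow> real) \<Rightarrow> real \<Rightarrow> 'a \<Rightarrow> real" where
  "cut_flux r \<eta> t x = (if t \<in> S then \<integral>y. flux_density t (r t) (\<eta> t) x y \<partial>M else 0)"

text \<open>One real function \<rho> controls the oscillation in time at all x and all p at once.
  Thus sampling converges at every point as soon as \<rho> is continuous.\<close>

definition regular :: "real \<Rightarrow> real \<Rightarrow> (real \<Rightarrow> real) \<Rightarrow> (real \<Rightarrow> 'a \<Rightarrow> real) \<Rightarrow> (real \<Rightarrow> 'a \<times> 'a \<Rightarrow> real) \<Rightarrow> bool" where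
  "regular R E \<rho> r \<eta> \<longleftrightarrow>
     continuous_on {0..T} \<rho> \<and>
     (\<forall>t\<in>{0..T}. bounded_state R E (r t) (\<eta> t)) \<and>
     (\<forall>s\<in>{0..T}. \<forall>t\<in>{0..T}.
        (\<forall>x. \<bar>r t x - r s x\<bar> \<le> \<bar>\<rho> t - \<rho> s\<bar> * \<alpha> x) \<and>
        (\<forall>p\<in>offdiag. \<bar>\<eta> t p - \<eta> s p\<bar> \<le> \<bar>\<rho> t - \<rho> s\<bar>))"

lemma bounded_state_L2:
  assumes "bounded_state R E g h"
  shows "g \<in> L2 M"
  using assms unfolding bounded_state_def by (blast intro: dominated_L2(1))

lemma bounded_state_mono:
  assumes "bounded_state R E g h" "R \<le> R'" "E \<le> E'"
  shows "bounded_state R' E' g h"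
  using assms \<alpha>_nonneg unfolding bounded_state_def
  by (meson mult_right_mono order_trans)

lemma modulus_sample_tendsto:
  assumes "regular R E \<rho> r \<eta>" "t \<in> {0..T}"
  shows "(\<lambda>k. \<bar>\<rho> (sample T k t) - \<rho> t\<bar>) \<longlonglongrightarrow> 0"
proof -
  have "(\<lambda>k. \<rho> (sample T k t)) \<longlonglongrightarrow> \<rho> t"
    using assms T_pos sample_in sample_tendsto[OF assms(2)]
    by (intro continuous_on_tendsto_compose[of "{0..T}" \<rho>]) (auto simp: regular_def)
  from tendsto_diff[OF this tendsto_const[of "\<rho> t"]] show ?thesis
    by (intro tendsto_rabs_zero) simp
qed

lemma time_measurable: "(\<lambda>t. t) \<in> borel_measurable (lebesgue_on {0..T})"
  by (intro measurable_restrict_space1 measurable_completion) simp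

lemma S_measurable': "Measurable.pred (lebesgue_on {0..T}) (\<lambda>t. t \<in> S)"
  using S_measurable by (intro measurable_restrict_space1) (simp add: pred_def)

lemma flux_density_joint_measurable:
  assumes "bounded_state R E g h"
  shows "(\<lambda>((t, x), y). flux_density t g h x y) \<in> borel_measurable ((lebesgue_on {0..T} \<Otimes>\<^sub>M M) \<Otimes>\<^sub>M M)"
proof -
  let ?X = "(lebesgue_on {0..T} \<Otimes>\<^sub>M M) \<Otimes>\<^sub>M M"
  have [measurable]: "g \<in> borel_measurable M"
    using assms by (simp add: bounded_state_def)
  have "(\<lambda>z. (fst (fst z), snd (fst z), snd z)) \<in> ?X \<rightarrow>\<^sub>M lebesgue_on {0..T} \<Otimes>\<^sub>M (borel \<Otimes>\<^sub>M borel)"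
    \<comment> \<open>The points carry the sigma-algebra of M, while measurability of the velocity
      is stated with \<open>borel\<close>; the rewriting identifies the two.\<close>
    unfolding measurable_cong_sets[OF refl sets_pair_measure_cong[OF refl sets_pair_measure_cong[OF sets_M[symmetric] sets_M[symmetric]]]]
    by measurable
  from measurable_compose[OF this velocity_measurable[OF bounded_state_L2[OF assms]]]
  have [measurable]: "(\<lambda>z. velocity (fst (fst z)) g (snd (fst z)) (snd z)) \<in> borel_measurable ?X"
    by simp
  have "(\<lambda>z. (snd (fst z), snd z)) \<in> ?X \<rightarrow>\<^sub>M borel \<Otimes>\<^sub>M borel"
    unfolding measurable_cong_sets[OF refl sets_pair_measure_cong[OF sets_M[symmetric] sets_M[symmetric]]]
    by measurable
  from measurable_compose[OF this weight_off_diag_measurable[of h]]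
  have [measurable]: "(\<lambda>z. weight_off_diag h (snd (fst z)) (snd z)) \<in> borel_measurable ?X"
    using assms by (simp add: bounded_state_def)
  show ?thesis
    unfolding flux_density_def case_prod_beta' by measurable
qed

text \<open>For a frozen state the flux density is jointly measurable. Sampling the state along the
  curve preserves this, and \<open>flux_Lipschitz\<close> bounds the sampling error by the
  oscillation of \<rho>.\<close>

lemma cut_flux_measurable:
  assumes reg: "regular R E \<rho> r \<eta>"
  shows "(\<lambda>(t, x). cut_flux r \<eta> t x) \<in> borel_measurable (lebesgue_on {0..T} \<Otimes>\<^sub>M M)"
proof -
  let ?X = "lebesgue_on {0..T} \<Otimes>\<^sub>M M"
  have st: "bounded_state R E (r t) (\<eta> t)" if "t \<in> {0..T}" for t
    using reg that by (auto simp: regular_def)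
  \<comment> \<open>Only the state is sampled. The explicit time argument of V stays the true time,
    in which V need not be continuous.\<close>
  define F where "F k z = (if fst z \<in> S then \<integral>y. flux_density (fst z)
    (r (sample T k (fst z))) (\<eta> (sample T k (fst z))) (snd z) y \<partial>M else 0)" for k z
  have [measurable]: "Measurable.pred ?X (\<lambda>z. fst z \<in> S)"
    by (rule measurable_compose[OF measurable_fst S_measurable'])
  have F[measurable]: "F k \<in> borel_measurable ?X" for k
  proof -
    have [measurable]: "(\<lambda>z. fst (fst z)) \<in> borel_measurable (?X \<Otimes>\<^sub>M M)"
      by (rule measurable_compose[OF measurable_fst measurable_compose[OF measurable_fst time_measurable]])
    have "(\<lambda>z. flux_density (fst (fst z)) (r s) (\<eta> s) (snd (fst z)) (snd z)) \<in> borel_measurable (?X \<Otimes>\<^sub>M M)"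
      if "s \<in> {0..T}" for s
      using flux_density_joint_measurable[OF st[OF that]] by (simp add: case_prod_beta')
    then have "(\<lambda>z. flux_density (fst (fst z)) (r (sample T k (fst (fst z)))) (\<eta> (sample T k (fst (fst z))))
        (snd (fst z)) (snd z)) \<in> borel_measurable (?X \<Otimes>\<^sub>M M)"
      using T_pos
      by (intro sample_measurable[where f="\<lambda>s z. flux_density (fst (fst z)) (r s) (\<eta> s) (snd (fst z)) (snd z)"]) auto
    then have "(\<lambda>(z, y). flux_density (fst z) (r (sample T k (fst z))) (\<eta> (sample T k (fst z))) (snd z) y)
      \<in> borel_measurable (?X \<Otimes>\<^sub>M M)"
      by (simp add: case_prod_beta')
    from borel_measurable_lebesgue_integral[OF this]
    show ?thesis
      unfolding F_def by measurable
  qed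
  have "(\<lambda>k. F k z) \<longlonglongrightarrow> cut_flux r \<eta> (fst z) (snd z)" for z
  proof (cases "fst z \<in> S")
    case True
    obtain t x where z: "z = (t, x)" by (cases z)
    have t: "t \<in> S" "t \<in> {0..T}" using True S_subset by (auto simp: z)
    have s: "sample T k t \<in> {0..T}" for k using sample_in T_pos by simp
    let ?d = "\<lambda>k. Lipschitz_const R E * B t * \<bar>\<rho> (sample T k t) - \<rho> t\<bar> * \<alpha> x"
    have le: "\<bar>F k z - cut_flux r \<eta> (fst z) (snd z)\<bar> \<le> ?d k" for k
    proof -
      have "\<bar>(\<integral>y. flux_density t (r (sample T k t)) (\<eta> (sample T k t)) x y \<partial>M)
          - (\<integral>y. flux_density t (r t) (\<eta> t) x y \<partial>M)\<bar> \<le> ?d k"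
        using reg s t by (intro flux_Lipschitz st) (auto simp: regular_def)
      with t show ?thesis by (simp add: F_def z cut_flux_def)
    qed
    have "?d \<longlonglongrightarrow> Lipschitz_const R E * B t * 0 * \<alpha> x"
      by (intro tendsto_intros modulus_sample_tendsto[OF reg t(2)])
    then have "?d \<longlonglongrightarrow> 0"
      by simp
    moreover have "\<forall>\<^sub>F k in sequentially. norm (F k z - cut_flux r \<eta> (fst z) (snd z)) \<le> ?d k"
      by (intro always_eventually allI) (simp only: real_norm_def le)
    ultimately have "(\<lambda>k. F k z - cut_flux r \<eta> (fst z) (snd z)) \<longlonglongrightarrow> 0"
      by (rule Lim_null_comparison[rotated])
    then show ?thesis by (simp add: LIM_zero_iff)
  qed (simp add: F_def cut_flux_def)
  then have "(\<lambda>z. cut_flux r \<eta> (fst z) (snd z)) \<in> borel_measurable ?X"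
    by (intro borel_measurable_LIMSEQ_real[OF _ F]) auto
  then show ?thesis by (simp add: case_prod_beta')
qed

section \<open>Time integrals of the flux and of the source\<close>

lemma cut_flux_bound:
  assumes "bounded_state R E (r t) (\<eta> t)" "t \<in> {0..T}"
  shows "\<bar>cut_flux r \<eta> t x\<bar> \<le> L * E * P * R * B t * \<alpha> x"
proof (cases "t \<in> S")
  case True
  then show ?thesis using flux_bound(2)[OF assms(1) True] by (simp add: cut_flux_def)
next
  case False
  have "0 \<le> L * E * P * R * B t * \<alpha> x"
    using bounded_state_nonneg[OF assms(1)] L_nonneg P_nonneg \<alpha>_nonneg B_ge_1[OF assms(2)] by simp
  with False show ?thesis by (simp add: cut_flux_def)
qed

lemma cut_flux_absolutely_integrable:
  assumes reg: "regular R E \<rho> r \<eta>"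
  shows "(\<lambda>t. cut_flux r \<eta> t x) absolutely_integrable_on {0..T}"
proof (rule measurable_bounded_by_integrable_imp_absolutely_integrable)
  have "(\<lambda>t. (t, x)) \<in> lebesgue_on {0..T} \<rightarrow>\<^sub>M lebesgue_on {0..T} \<Otimes>\<^sub>M M"
    by (intro measurable_Pair) (auto simp: sets_eq_imp_space_eq[OF sets_M])
  from measurable_compose[OF this cut_flux_measurable[OF reg]]
  show "(\<lambda>t. cut_flux r \<eta> t x) \<in> borel_measurable (lebesgue_on {0..T})" by simp
  show "norm (cut_flux r \<eta> t x) \<le> L * E * P * R * B t * \<alpha> x" if "t \<in> {0..T}" for t
    using cut_flux_bound[of R E r t \<eta> x] reg that by (auto simp: regular_def)
  show "(\<lambda>t. L * E * P * R * B t * \<alpha> x) integrable_on {0..T}"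
    by (intro integrable_on_mult_left integrable_on_mult_right B_integrable)
qed simp

text \<open>With the upper limit moved into an indicator, the integral is taken over a fixed finite
  measure, where measurability in a parameter follows from joint measurability.\<close>

lemma integral_upto_eq_lebesgue_on:
  fixes f :: "real \<Rightarrow> real"
  assumes "f absolutely_integrable_on {0..T}" "t \<in> {0..T}"
  shows "integral {0..t} f = (\<integral>s. indicator {0..t} s * f s \<partial>lebesgue_on {0..T})"
proof -
  have "f absolutely_integrable_on {0..t}"
    using assms by (auto intro: absolutely_integrable_on_subinterval)
  then have "integral {0..t} f = (LINT s:{0..t}|lebesgue. f s)"
    by (simp add: set_lebesgue_integral_eq_integral)
  also have "\<dots> = (\<integral>s. indicator {0..t} s * f s \<partial>lebesgue_on {0..T})"
    unfolding set_lebesgue_integral_def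
    using assms(2) by (subst integral_restrict_space) (auto intro!: Bochner_Integration.integral_cong simp: indicator_def)
  finally show ?thesis .
qed

lemma flux_time_integral_measurable:
  assumes reg: "regular R E \<rho> r \<eta>" and t: "t \<in> {0..T}"
  shows "(\<lambda>x. integral {0..t} (\<lambda>s. cut_flux r \<eta> s x)) \<in> borel_measurable M"
proof -
  interpret time: finite_measure "lebesgue_on {0..T}"
    by (rule finite_measure_lebesgue_on) simp
  have [measurable]: "(\<lambda>s. indicator {0..t} s :: real) \<in> borel_measurable (lebesgue_on {0..T})"
    by (rule measurable_compose[OF time_measurable]) simp
  have [measurable]: "(\<lambda>(x, s). cut_flux r \<eta> s x) \<in> borel_measurable (M \<Otimes>\<^sub>M lebesgue_on {0..T})"
    using measurable_compose[OF measurable_pair_swap' cut_flux_measurable[OF reg]]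
    by (simp add: case_prod_beta')
  have "(\<lambda>x. \<integral>s. indicator {0..t} s * cut_flux r \<eta> s x \<partial>lebesgue_on {0..T}) \<in> borel_measurable M"
    by (rule time.borel_measurable_lebesgue_integral) measurable
  then show ?thesis
    by (simp add: integral_upto_eq_lebesgue_on[OF cut_flux_absolutely_integrable[OF reg] t])
qed

text \<open>The sampling argument again: \<omega> is measurable in time for a fixed density, and its
  Lipschitz bound controls the error made by freezing the density on the grid.\<close>

lemma source_absolutely_integrable:
  assumes reg: "regular R E \<rho> r \<eta>" and p: "p \<in> offdiag"
  shows "(\<lambda>t. \<omega> t (r t) p - \<eta> t p) absolutely_integrable_on {0..T}"
proof (rule measurable_bounded_by_integrable_imp_absolutely_integrable)
  let ?X = "lebesgue_on {0..T}"
  have st: "bounded_state R E (r t) (\<eta> t)" if "t \<in> {0..T}" for t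
    using reg that by (auto simp: regular_def)
  have s: "sample T k t \<in> {0..T}" for k t using sample_in T_pos by simp
  have rd: "\<bar>r t x - r s x\<bar> \<le> \<bar>\<rho> t - \<rho> s\<bar> * \<alpha> x" if "s \<in> {0..T}" "t \<in> {0..T}" for s t x
    using reg that by (auto simp: regular_def)
  have hd: "\<bar>\<eta> t p - \<eta> s p\<bar> \<le> \<bar>\<rho> t - \<rho> s\<bar>" if "s \<in> {0..T}" "t \<in> {0..T}" for s t
    using reg that p by (auto simp: regular_def)
  define G where "G k t = \<omega> t (r (sample T k t)) p - \<eta> (sample T k t) p" for k t
  have G: "G k \<in> borel_measurable ?X" for k
    unfolding G_def
    using T_pos p bounded_state_L2[OF st] \<omega>_measurable
    by (intro sample_measurable[where f="\<lambda>s t. \<omega> t (r s) p - \<eta> s p" and u="\<lambda>t. t"] time_measurable)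
      auto
  have conv: "(\<lambda>k. G k t) \<longlonglongrightarrow> \<omega> t (r t) p - \<eta> t p" if t: "t \<in> {0..T}" for t
  proof -
    let ?d = "\<lambda>k. L\<omega> * (\<bar>\<rho> (sample T k t) - \<rho> t\<bar> * N) + \<bar>\<rho> (sample T k t) - \<rho> t\<bar>"
    have le: "\<bar>G k t - (\<omega> t (r t) p - \<eta> t p)\<bar> \<le> ?d k" for k
    proof -
      have "L2_norm M (\<lambda>x. r (sample T k t) x - r t x) \<le> \<bar>\<rho> (sample T k t) - \<rho> t\<bar> * N"
        using rd[OF t s] st[OF t] st[OF s[of k t]]
        by (intro dominated_L2(2) borel_measurable_diff) (auto simp: bounded_state_def)
      then have "\<bar>\<omega> t (r (sample T k t)) p - \<omega> t (r t) p\<bar> \<le> L\<omega> * (\<bar>\<rho> (sample T k t) - \<rho> t\<bar> * N)"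
        using \<omega>_Lipschitz[OF t bounded_state_L2[OF st[OF s]] bounded_state_L2[OF st[OF t]] p] L\<omega>_nonneg
        by (meson mult_left_mono order_trans)
      with hd[OF t s[of k t]] show ?thesis
        unfolding G_def by linarith
    qed
    have "?d \<longlonglongrightarrow> L\<omega> * (0 * N) + 0"
      by (intro tendsto_intros modulus_sample_tendsto[OF reg t])
    then have "?d \<longlonglongrightarrow> 0"
      by simp
    moreover have "\<forall>\<^sub>F k in sequentially. norm (G k t - (\<omega> t (r t) p - \<eta> t p)) \<le> ?d k"
      by (intro always_eventually allI) (simp only: real_norm_def le)
    ultimately have "(\<lambda>k. G k t - (\<omega> t (r t) p - \<eta> t p)) \<longlonglongrightarrow> 0"
      by (rule Lim_null_comparison[rotated])
    then show ?thesis by (simp add: LIM_zero_iff)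
  qed
  show "(\<lambda>t. \<omega> t (r t) p - \<eta> t p) \<in> borel_measurable ?X"
  proof (rule borel_measurable_LIMSEQ_real)
    show "(\<lambda>k. G k t) \<longlonglongrightarrow> \<omega> t (r t) p - \<eta> t p" if "t \<in> space ?X" for t
      using that by (intro conv) simp
  qed (rule G)
  show "norm (\<omega> t (r t) p - \<eta> t p) \<le> C\<omega> + E" if "t \<in> {0..T}" for t
    using \<omega>_bound[OF that bounded_state_L2[OF st[OF that]] p] st[OF that] p
    by (force simp: bounded_state_def)
qed (auto simp: integrable_const_ivl)

text \<open>Dominated convergence along a sequence of points: the integrand is continuous in p at
  each time and bounded by the constant C\<omega> + E.\<close>

lemma source_time_integral_continuous:
  assumes reg: "regular R E \<rho> r \<eta>" and t: "t \<in> {0..T}"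
  shows "continuous_on offdiag (\<lambda>p. integral {0..t} (\<lambda>s. \<omega> s (r s) p - \<eta> s p))"
  unfolding continuous_on_sequentially comp_def
proof safe
  \<comment> \<open>Here \<open>P\<close> is a sequence of points and hides the constant of the same
    name.\<close>
  fix P :: "nat \<Rightarrow> 'a \<times> 'a" and a b
  assume P: "\<forall>n. P n \<in> offdiag" and ab: "(a, b) \<in> offdiag" and lim: "P \<longlonglongrightarrow> (a, b)"
  have st: "bounded_state R E (r s) (\<eta> s)" if "s \<in> {0..T}" for s
    using reg that by (auto simp: regular_def)
  show "(\<lambda>n. integral {0..t} (\<lambda>s. \<omega> s (r s) (P n) - \<eta> s (P n)))
    \<longlonglongrightarrow> integral {0..t} (\<lambda>s. \<omega> s (r s) (a, b) - \<eta> s (a, b))"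
  proof (rule dominated_convergence(2))
    fix n
    show "(\<lambda>s. \<omega> s (r s) (P n) - \<eta> s (P n)) integrable_on {0..t}"
      using t P absolutely_integrable_on_subinterval[OF source_absolutely_integrable[OF reg]]
      by (intro set_lebesgue_integral_eq_integral(1)) auto
  next
    fix n s assume "s \<in> {0..t}"
    then have s: "s \<in> {0..T}" using t by auto
    show "norm (\<omega> s (r s) (P n) - \<eta> s (P n)) \<le> C\<omega> + E"
    proof -
      have "P n \<in> offdiag" using P by blast
      then have "\<bar>\<omega> s (r s) (P n)\<bar> \<le> C\<omega>" "\<bar>\<eta> s (P n)\<bar> \<le> E"
        using \<omega>_bound[OF s bounded_state_L2[OF st[OF s]]] st[OF s] by (auto simp: bounded_state_def)
      then show ?thesis by simp
    qed
  next
    fix s assume "s \<in> {0..t}"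
    then have s: "s \<in> {0..T}" using t by auto
    have "continuous_on offdiag (\<lambda>p. \<omega> s (r s) p - \<eta> s p)"
      using st[OF s] \<omega>_continuous[OF s bounded_state_L2[OF st[OF s]]]
      by (intro continuous_intros) (auto simp: bounded_state_def)
    then show "(\<lambda>n. \<omega> s (r s) (P n) - \<eta> s (P n)) \<longlonglongrightarrow> \<omega> s (r s) (a, b) - \<eta> s (a, b)"
      using continuous_on_tendsto_compose lim ab P by fastforce
  qed auto
qed

section \<open>Picard iteration\<close>

definition picard_r :: "(real \<Rightarrow> 'a \<Rightarrow> real) \<Rightarrow> (real \<Rightarrow> 'a \<times> 'a \<Rightarrow> real) \<Rightarrow> real \<Rightarrow> 'a \<Rightarrow> real" where
  "picard_r r \<eta> t x = r0 x - integral {0..t} (\<lambda>s. cut_flux r \<eta> s x)"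

definition picard_\<eta> :: "(real \<Rightarrow> 'a \<Rightarrow> real) \<Rightarrow> (real \<Rightarrow> 'a \<times> 'a \<Rightarrow> real) \<Rightarrow> real \<Rightarrow> 'a \<times> 'a \<Rightarrow> real" where
  "picard_\<eta> r \<eta> t p = \<eta>0 p + integral {0..t} (\<lambda>s. \<omega> s (r s) p - \<eta> s p)"

section \<open>Time weights and a priori constants\<close>

definition source_size :: real where
  "source_size = E0 + C\<omega> * T"

text \<open>The rate 1 is that of the damping term -\<eta>; the contribution of \<omega> is already
  contained in \<open>source_size\<close>.\<close>

definition weight_\<eta> :: "real \<Rightarrow> real" where
  "weight_\<eta> = (SOME w. growth_weight T (\<lambda>_. 1) w)"

definition bound_\<eta> :: real where
  "bound_\<eta> = 2 * source_size * weight_\<eta> T"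

text \<open>The factor of \<open>R * \<alpha> x\<close> in \<open>flux_bound\<close> when E is
  \<open>bound_\<eta>\<close>: the linear growth rate of r.\<close>

definition rate_r :: "real \<Rightarrow> real" where
  "rate_r t = L * bound_\<eta> * P * B t"

definition weight_r :: "real \<Rightarrow> real" where
  "weight_r = (SOME w. growth_weight T rate_r w)"

definition bound_r :: real where
  "bound_r = 2 * weight_r T"

text \<open>The summands are the Lipschitz constants of the flux, of \<omega> and of the damping.
  They are added so that one weight serves both components, and B t \<ge> 1 allows the common factor
  B t.\<close>

definition rate_diff :: "real \<Rightarrow> real" where
  "rate_diff t = (Lipschitz_const bound_r bound_\<eta> + L\<omega> * N + 1) * B t"

definition weight_diff :: "real \<Rightarrow> real" where
  "weight_diff = (SOME w. growth_weight T rate_diff w)"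

text \<open>A sum, so as to dominate both the flux divided by \<alpha> and the source. Its primitive
  \<open>modulus\<close> plays the role of \<rho> in \<open>regular\<close>, and
  \<open>speed\<close> itself yields the integrable functions required by absolute
  continuity.\<close>

definition speed :: "real \<Rightarrow> real" where
  "speed t = L * bound_\<eta> * P * bound_r * B t + (C\<omega> + bound_\<eta>)"

definition modulus :: "real \<Rightarrow> real" where
  "modulus t = integral {0..t} speed"

lemma B_nonneg: "t \<in> {0..T} \<Longrightarrow> 0 \<le> B t"
  using B_ge_1 by fastforce

lemma source_size_nonneg: "0 \<le> source_size"
  using E0_nonneg C\<omega>_nonneg T_pos by (simp add: source_size_def)

lemma weight_\<eta>: "growth_weight T (\<lambda>_. 1) weight_\<eta>"
  unfolding weight_\<eta>_def by (intro someI_ex[OF growth_weight_exists]) (auto simp: integrable_const_ivl)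

lemma weight_\<eta>_mono: "0 \<le> s \<Longrightarrow> s \<le> t \<Longrightarrow> t \<le> T \<Longrightarrow> weight_\<eta> s \<le> weight_\<eta> t"
  and weight_\<eta>_ge_1: "t \<in> {0..T} \<Longrightarrow> 1 \<le> weight_\<eta> t"
  by (rule growth_weightD[OF weight_\<eta>]; assumption)+

lemma bound_\<eta>_nonneg: "0 \<le> bound_\<eta>"
  unfolding bound_\<eta>_def using source_size_nonneg weight_\<eta>_ge_1[of T] T_pos
  by (intro mult_nonneg_nonneg) auto

lemma weight_r: "growth_weight T rate_r weight_r"
  unfolding weight_r_def rate_r_def
  using bound_\<eta>_nonneg L_nonneg P_nonneg B_nonneg
  by (intro someI_ex[OF growth_weight_exists] integrable_on_mult_right B_integrable) auto

lemma weight_r_mono: "0 \<le> s \<Longrightarrow> s \<le> t \<Longrightarrow> t \<le> T \<Longrightarrow> weight_r s \<le> weight_r t"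
  and weight_r_ge_1: "t \<in> {0..T} \<Longrightarrow> 1 \<le> weight_r t"
  by (rule growth_weightD[OF weight_r]; assumption)+

lemma bound_r_nonneg: "0 \<le> bound_r"
  using weight_r_ge_1[of T] T_pos by (simp add: bound_r_def)

lemma Lipschitz_const_nonneg: "0 \<le> Lipschitz_const bound_r bound_\<eta>"
  unfolding Lipschitz_const_def
  using L_nonneg P_nonneg bound_\<eta>_nonneg bound_r_nonneg LV_nonneg N_nonneg by simp

lemma weight_diff: "growth_weight T rate_diff weight_diff"
  unfolding weight_diff_def rate_diff_def
  using Lipschitz_const_nonneg L\<omega>_nonneg N_nonneg B_nonneg
  by (intro someI_ex[OF growth_weight_exists] integrable_on_mult_right B_integrable) auto

lemma weight_diff_ge_1: "t \<in> {0..T} \<Longrightarrow> 1 \<le> weight_diff t"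
  by (rule growth_weightD(2)[OF weight_diff])

lemma speed_integrable: "speed integrable_on {0..T}"
  unfolding speed_def[abs_def]
  by (intro integrable_add integrable_on_mult_right B_integrable integrable_const_ivl)

lemma speed_nonneg: "t \<in> {0..T} \<Longrightarrow> 0 \<le> speed t"
  unfolding speed_def
  using bound_\<eta>_nonneg bound_r_nonneg L_nonneg P_nonneg B_nonneg C\<omega>_nonneg by simp

lemma modulus_increment:
  assumes "0 \<le> s" "s \<le> t" "t \<le> T"
  shows "modulus t - modulus s = integral {s..t} speed"
  unfolding modulus_def by (rule integral_increment[OF speed_integrable assms])

lemma modulus_continuous: "continuous_on {0..T} modulus"
  unfolding modulus_def by (rule indefinite_integral_continuous_1[OF speed_integrable])

text \<open>The bounds vary with time because only in this form do they reproduce themselves under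
  the Picard map; \<open>bound_r\<close> and \<open>bound_\<eta>\<close> are their values at T. The
  increment clauses use these final constants through \<open>speed\<close>.\<close>

definition invariant :: "(real \<Rightarrow> 'a \<Rightarrow> real) \<Rightarrow> (real \<Rightarrow> 'a \<times> 'a \<Rightarrow> real) \<Rightarrow> bool" where
  "invariant r \<eta> \<longleftrightarrow>
     (\<forall>t\<in>{0..T}. bounded_state (2 * weight_r t) (2 * source_size * weight_\<eta> t) (r t) (\<eta> t)) \<and>
     (\<forall>s t. 0 \<le> s \<longrightarrow> s \<le> t \<longrightarrow> t \<le> T \<longrightarrow>
        (\<forall>x. \<bar>r t x - r s x\<bar> \<le> (modulus t - modulus s) * \<alpha> x) \<and>
        (\<forall>p\<in>offdiag. \<bar>\<eta> t p - \<eta> s p\<bar> \<le> modulus t - modulus s))"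

text \<open>The form with \<open>weight_r t\<close> is kept for the growth estimate of r, where the
  density bound must stay under the time integral; elsewhere constants suffice.\<close>

lemma invariant_state:
  assumes "invariant r \<eta>" "t \<in> {0..T}"
  shows "bounded_state (2 * weight_r t) bound_\<eta> (r t) (\<eta> t)"
    and "bounded_state bound_r bound_\<eta> (r t) (\<eta> t)"
proof -
  have "2 * source_size * weight_\<eta> t \<le> bound_\<eta>"
    unfolding bound_\<eta>_def using assms(2) source_size_nonneg weight_\<eta>_mono[of t T]
    by (intro mult_left_mono) auto
  then show st: "bounded_state (2 * weight_r t) bound_\<eta> (r t) (\<eta> t)"
    using assms by (auto simp: invariant_def intro: bounded_state_mono)
  show "bounded_state bound_r bound_\<eta> (r t) (\<eta> t)"
    using assms(2) weight_r_mono[of t T] by (intro bounded_state_mono[OF st]) (auto simp: bound_r_def)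
qed

lemma invariant_regular:
  assumes inv: "invariant r \<eta>"
  shows "regular bound_r bound_\<eta> modulus r \<eta>"
  unfolding regular_def
proof (intro conjI ballI modulus_continuous invariant_state[OF inv])
  have ordered: "\<bar>r t x - r s x\<bar> \<le> \<bar>modulus t - modulus s\<bar> * \<alpha> x \<and> (p \<in> offdiag \<longrightarrow> \<bar>\<eta> t p - \<eta> s p\<bar> \<le> \<bar>modulus t - modulus s\<bar>)"
    if "0 \<le> s" "s \<le> t" "t \<le> T" for s t x p
  proof -
    have "\<bar>r t x - r s x\<bar> \<le> (modulus t - modulus s) * \<alpha> x"
      using inv that by (auto simp: invariant_def)
    also have "\<dots> \<le> \<bar>modulus t - modulus s\<bar> * \<alpha> x"
      using \<alpha>_nonneg by (intro mult_right_mono) auto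
    finally have "\<bar>r t x - r s x\<bar> \<le> \<bar>modulus t - modulus s\<bar> * \<alpha> x" .
    moreover have "p \<in> offdiag \<longrightarrow> \<bar>\<eta> t p - \<eta> s p\<bar> \<le> modulus t - modulus s"
      using inv that by (auto simp: invariant_def)
    ultimately show ?thesis by force
  qed
  fix s t assume "s \<in> {0..T}" "t \<in> {0..T}"
  then show "\<forall>x. \<bar>r t x - r s x\<bar> \<le> \<bar>modulus t - modulus s\<bar> * \<alpha> x"
    and "\<And>p. p \<in> offdiag \<Longrightarrow> \<bar>\<eta> t p - \<eta> s p\<bar> \<le> \<bar>modulus t - modulus s\<bar>"
    using ordered[of s t] ordered[of t s]
    by (cases "s \<le> t"; simp add: abs_minus_commute)+
qed auto

lemma cut_flux_integrable:
  assumes "invariant r \<eta>"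
  shows "(\<lambda>s. cut_flux r \<eta> s x) integrable_on {0..T}"
  using cut_flux_absolutely_integrable[OF invariant_regular[OF assms]]
  by (rule set_lebesgue_integral_eq_integral(1))

lemma source_integrable:
  assumes "invariant r \<eta>" "p \<in> offdiag"
  shows "(\<lambda>s. \<omega> s (r s) p - \<eta> s p) integrable_on {0..T}"
  using source_absolutely_integrable[OF invariant_regular[OF assms(1)] assms(2)]
  by (rule set_lebesgue_integral_eq_integral(1))

lemma source_bound:
  assumes "bounded_state R E (r t) (\<eta> t)" "t \<in> {0..T}" "p \<in> offdiag"
  shows "\<bar>\<omega> t (r t) p - \<eta> t p\<bar> \<le> C\<omega> + E"
  using \<omega>_bound[OF assms(2) bounded_state_L2[OF assms(1)] assms(3)] assms(1,3)
  by (force simp: bounded_state_def)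

text \<open>Each component of the image is its initial datum plus a time integral. The weight
  inequality turns the doubled bound under the integral back into a single one, and a weight of at
  least 1 pays for the initial datum.\<close>

lemma picard_invariant:
  assumes inv: "invariant r \<eta>"
  shows "invariant (picard_r r \<eta>) (picard_\<eta> r \<eta>)"
  unfolding invariant_def
proof (intro conjI ballI allI impI)
  fix t assume t: "t \<in> {0..T}"
  have reg: "regular bound_r bound_\<eta> modulus r \<eta>"
    by (rule invariant_regular[OF inv])
  show "bounded_state (2 * weight_r t) (2 * source_size * weight_\<eta> t) (picard_r r \<eta> t) (picard_\<eta> r \<eta> t)"
    unfolding bounded_state_def
  proof (intro conjI allI ballI)
    show "picard_r r \<eta> t \<in> borel_measurable M"
      unfolding picard_r_def using flux_time_integral_measurable[OF reg t] by measurable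
    show "continuous_on offdiag (picard_\<eta> r \<eta> t)"
      unfolding picard_\<eta>_def
      by (intro continuous_intros \<eta>0_continuous source_time_integral_continuous[OF reg t])
  next
    fix x
    have "\<bar>integral {0..t} (\<lambda>s. cut_flux r \<eta> s x)\<bar> \<le> integral {0..t} (\<lambda>s. 2 * \<alpha> x * (rate_r s * weight_r s))"
    proof (rule integral_abs_le[OF cut_flux_integrable[OF inv]])
      show "(\<lambda>s. 2 * \<alpha> x * (rate_r s * weight_r s)) integrable_on {0..T}"
        by (rule integrable_on_mult_right[OF growth_weightD(3)[OF weight_r]])
      show "\<bar>cut_flux r \<eta> s x\<bar> \<le> 2 * \<alpha> x * (rate_r s * weight_r s)" if "s \<in> {0..t}" for s
        using cut_flux_bound[where r=r and \<eta>=\<eta>, OF invariant_state(1)[OF inv], of s x] that t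
        by (simp add: rate_r_def mult_ac)
    qed (use t in auto)
    also have "\<dots> = 2 * \<alpha> x * integral {0..t} (\<lambda>s. rate_r s * weight_r s)"
      by simp
    also have "\<dots> \<le> 2 * \<alpha> x * (weight_r t / 2)"
      using \<alpha>_nonneg by (intro mult_left_mono growth_weightD(4)[OF weight_r t]) auto
    finally have "\<bar>integral {0..t} (\<lambda>s. cut_flux r \<eta> s x)\<bar> \<le> \<alpha> x * weight_r t"
      by simp
    moreover have "\<bar>r0 x\<bar> \<le> \<alpha> x"
      by (simp add: \<alpha>_def)
    ultimately have "\<bar>picard_r r \<eta> t x\<bar> \<le> \<alpha> x + \<alpha> x * weight_r t"
      unfolding picard_r_def by linarith
    moreover have "\<alpha> x * 1 \<le> \<alpha> x * weight_r t"
      using weight_r_ge_1[OF t] \<alpha>_nonneg by (intro mult_left_mono) auto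
    ultimately show "\<bar>picard_r r \<eta> t x\<bar> \<le> 2 * weight_r t * \<alpha> x"
      by (simp add: mult_ac)
  next
    fix p :: "'a \<times> 'a" assume p: "p \<in> offdiag"
    have w_int: "weight_\<eta> integrable_on {0..T}"
      using growth_weightD(3)[OF weight_\<eta>] by simp
    have w_sub: "weight_\<eta> integrable_on {0..t}"
      using integrable_subinterval_real[OF w_int] t by auto
    have "\<bar>integral {0..t} (\<lambda>s. \<omega> s (r s) p - \<eta> s p)\<bar>
        \<le> integral {0..t} (\<lambda>s. C\<omega> + 2 * source_size * weight_\<eta> s)"
    proof (rule integral_abs_le[OF source_integrable[OF inv p]])
      show "(\<lambda>s. C\<omega> + 2 * source_size * weight_\<eta> s) integrable_on {0..T}"
        by (intro integrable_add integrable_on_mult_right w_int integrable_const_ivl)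
      show "\<bar>\<omega> s (r s) p - \<eta> s p\<bar> \<le> C\<omega> + 2 * source_size * weight_\<eta> s" if "s \<in> {0..t}" for s
        using that t p inv
        by (intro source_bound[where R="2 * weight_r s"]) (auto simp: invariant_def)
    qed (use t in auto)
    also have "\<dots> = C\<omega> * t + 2 * source_size * integral {0..t} weight_\<eta>"
      using t w_sub
      by (subst Henstock_Kurzweil_Integration.integral_add)
        (auto intro!: integrable_on_mult_right simp: integrable_const_ivl)
    also have "\<dots> \<le> C\<omega> * T + 2 * source_size * (weight_\<eta> t / 2)"
      using growth_weightD(4)[OF weight_\<eta> t] t C\<omega>_nonneg source_size_nonneg
      by (intro add_mono mult_left_mono) auto
    finally have "\<bar>integral {0..t} (\<lambda>s. \<omega> s (r s) p - \<eta> s p)\<bar> \<le> C\<omega> * T + source_size * weight_\<eta> t"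
      by simp
    moreover have "\<bar>\<eta>0 p\<bar> + C\<omega> * T \<le> source_size"
      using \<eta>0_bound[OF p] by (simp add: source_size_def)
    ultimately have "\<bar>picard_\<eta> r \<eta> t p\<bar> \<le> source_size + source_size * weight_\<eta> t"
      unfolding picard_\<eta>_def by linarith
    moreover have "source_size * 1 \<le> source_size * weight_\<eta> t"
      using weight_\<eta>_ge_1[OF t] source_size_nonneg by (intro mult_left_mono) auto
    ultimately show "\<bar>picard_\<eta> r \<eta> t p\<bar> \<le> 2 * source_size * weight_\<eta> t"
      by (simp add: mult_ac)
  qed
next
  fix s t x assume st: "0 \<le> s" "s \<le> t" "t \<le> T"
  have "\<bar>integral {s..t} (\<lambda>s. cut_flux r \<eta> s x)\<bar> \<le> integral {s..t} (\<lambda>s. speed s * \<alpha> x)"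
  proof (rule integral_abs_le[OF cut_flux_integrable[OF inv] integrable_on_mult_left[OF speed_integrable]])
    show "\<bar>cut_flux r \<eta> u x\<bar> \<le> speed u * \<alpha> x" if "u \<in> {s..t}" for u
    proof -
      have u: "u \<in> {0..T}" using that st by auto
      have "0 \<le> (C\<omega> + bound_\<eta>) * \<alpha> x"
        using C\<omega>_nonneg bound_\<eta>_nonneg \<alpha>_nonneg by simp
      with cut_flux_bound[where r=r and \<eta>=\<eta>, OF invariant_state(2)[OF inv u] u, of x] show ?thesis
        unfolding speed_def distrib_right by linarith
    qed
  qed (use st in auto)
  then show "\<bar>picard_r r \<eta> t x - picard_r r \<eta> s x\<bar> \<le> (modulus t - modulus s) * \<alpha> x"
    using integral_increment[OF cut_flux_integrable[OF inv, of x] st]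
    by (simp add: picard_r_def modulus_increment[OF st] abs_minus_commute)
next
  fix s t and p :: "'a \<times> 'a" assume st: "0 \<le> s" "s \<le> t" "t \<le> T" and p: "p \<in> offdiag"
  have "\<bar>integral {s..t} (\<lambda>s. \<omega> s (r s) p - \<eta> s p)\<bar> \<le> integral {s..t} speed"
  proof (rule integral_abs_le[OF source_integrable[OF inv p] speed_integrable])
    show "\<bar>\<omega> u (r u) p - \<eta> u p\<bar> \<le> speed u" if "u \<in> {s..t}" for u
    proof -
      have u: "u \<in> {0..T}" using that st by auto
      have "0 \<le> L * bound_\<eta> * P * bound_r * B u"
        using bound_\<eta>_nonneg bound_r_nonneg L_nonneg P_nonneg B_nonneg[OF u] by simp
      with source_bound[where r=r and \<eta>=\<eta>, OF invariant_state(2)[OF inv u] u p] show ?thesis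
        unfolding speed_def by linarith
    qed
  qed (use st in auto)
  then show "\<bar>picard_\<eta> r \<eta> t p - picard_\<eta> r \<eta> s p\<bar> \<le> modulus t - modulus s"
    using integral_increment[OF source_integrable[OF inv p] st]
    by (simp add: picard_\<eta>_def modulus_increment[OF st])
qed

text \<open>At each time the difference of the integrands is at most d times
  \<open>rate_diff * weight_diff\<close>, with an extra factor \<alpha> x for the flux. The weight
  inequality integrates this to half the original distance.\<close>

lemma picard_contraction:
  assumes inv: "invariant r \<eta>" and inv': "invariant r' \<eta>'" and d: "0 \<le> d"
    and r: "\<And>t x. t \<in> {0..T} \<Longrightarrow> \<bar>r t x - r' t x\<bar> \<le> d * weight_diff t * \<alpha> x"
    and \<eta>: "\<And>t p. t \<in> {0..T} \<Longrightarrow> p \<in> offdiag \<Longrightarrow> \<bar>\<eta> t p - \<eta>' t p\<bar> \<le> d * weight_diff t"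
    and t: "t \<in> {0..T}"
  shows "\<bar>picard_r r \<eta> t x - picard_r r' \<eta>' t x\<bar> \<le> d / 2 * weight_diff t * \<alpha> x"
    and "p \<in> offdiag \<Longrightarrow> \<bar>picard_\<eta> r \<eta> t p - picard_\<eta> r' \<eta>' t p\<bar> \<le> d / 2 * weight_diff t"
proof -
  have w_int: "(\<lambda>s. rate_diff s * weight_diff s) integrable_on {0..T}"
    and w_le: "integral {0..t} (\<lambda>s. rate_diff s * weight_diff s) \<le> weight_diff t / 2"
    by (rule growth_weightD[OF weight_diff] t)+
  have sub: "f integrable_on {0..t}" if "f integrable_on {0..T}" for f :: "real \<Rightarrow> real"
    using integrable_subinterval_real[OF that] t by auto
  have dw: "0 \<le> d * weight_diff s" if "s \<in> {0..T}" for s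
    using d weight_diff_ge_1[OF that] by (intro mult_nonneg_nonneg) auto
  have rate_split: "rate_diff s = Lipschitz_const bound_r bound_\<eta> * B s + L\<omega> * N * B s + B s"
    and rate_nonneg: "0 \<le> Lipschitz_const bound_r bound_\<eta> * B s" "0 \<le> L\<omega> * N * (B s - 1)"
    if "s \<in> {0..T}" for s
    using Lipschitz_const_nonneg L\<omega>_nonneg N_nonneg B_nonneg[OF that] B_ge_1[OF that]
    by (simp_all add: rate_diff_def distrib_right)
  have "\<bar>integral {0..t} (\<lambda>s. cut_flux r \<eta> s x - cut_flux r' \<eta>' s x)\<bar>
      \<le> integral {0..t} (\<lambda>s. d * \<alpha> x * (rate_diff s * weight_diff s))"
  proof (rule integral_abs_le)
    show "(\<lambda>s. cut_flux r \<eta> s x - cut_flux r' \<eta>' s x) integrable_on {0..T}"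
      by (intro integrable_diff cut_flux_integrable inv inv')
    show "(\<lambda>s. d * \<alpha> x * (rate_diff s * weight_diff s)) integrable_on {0..T}"
      by (intro integrable_on_mult_right w_int)
    show "\<bar>cut_flux r \<eta> s x - cut_flux r' \<eta>' s x\<bar> \<le> d * \<alpha> x * (rate_diff s * weight_diff s)"
      if "s \<in> {0..t}" for s
    proof -
      have s: "s \<in> {0..T}" using that t by auto
      have "\<bar>cut_flux r \<eta> s x - cut_flux r' \<eta>' s x\<bar>
          \<le> (Lipschitz_const bound_r bound_\<eta> * B s) * (d * weight_diff s * \<alpha> x)"
      proof (cases "s \<in> S")
        case True
        have "\<bar>(\<integral>y. flux_density s (r s) (\<eta> s) x y \<partial>M) - (\<integral>y. flux_density s (r' s) (\<eta>' s) x y \<partial>M)\<bar>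
            \<le> Lipschitz_const bound_r bound_\<eta> * B s * (d * weight_diff s) * \<alpha> x"
          by (intro flux_Lipschitz invariant_state(2) inv inv' s True r \<eta>)
        with True show ?thesis by (simp add: cut_flux_def mult_ac)
      next
        case False
        have "0 \<le> (Lipschitz_const bound_r bound_\<eta> * B s) * (d * weight_diff s * \<alpha> x)"
          by (intro mult_nonneg_nonneg rate_nonneg s dw \<alpha>_nonneg)
        with False show ?thesis by (simp add: cut_flux_def)
      qed
      also have "\<dots> \<le> rate_diff s * (d * weight_diff s * \<alpha> x)"
        using rate_split[OF s] B_nonneg[OF s] L\<omega>_nonneg N_nonneg
        by (intro mult_right_mono[OF _ mult_nonneg_nonneg[OF dw[OF s] \<alpha>_nonneg]]) simp
      finally show ?thesis by (simp add: mult_ac)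
    qed
  qed (use t in auto)
  also have "\<dots> \<le> d * \<alpha> x * (weight_diff t / 2)"
    using mult_left_mono[OF w_le, of "d * \<alpha> x"] d \<alpha>_nonneg[of x] by simp
  finally show "\<bar>picard_r r \<eta> t x - picard_r r' \<eta>' t x\<bar> \<le> d / 2 * weight_diff t * \<alpha> x"
    using sub[OF cut_flux_integrable[OF inv, of x]] sub[OF cut_flux_integrable[OF inv', of x]]
    by (simp add: picard_r_def Henstock_Kurzweil_Integration.integral_diff mult_ac abs_minus_commute)
  assume p: "p \<in> offdiag"
  have "\<bar>integral {0..t} (\<lambda>s. (\<omega> s (r s) p - \<eta> s p) - (\<omega> s (r' s) p - \<eta>' s p))\<bar>
      \<le> integral {0..t} (\<lambda>s. d * (rate_diff s * weight_diff s))"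
  proof (rule integral_abs_le)
    show "(\<lambda>s. (\<omega> s (r s) p - \<eta> s p) - (\<omega> s (r' s) p - \<eta>' s p)) integrable_on {0..T}"
      by (intro integrable_diff[OF source_integrable[OF inv p] source_integrable[OF inv' p]])
    show "(\<lambda>s. d * (rate_diff s * weight_diff s)) integrable_on {0..T}"
      by (intro integrable_on_mult_right w_int)
    show "\<bar>(\<omega> s (r s) p - \<eta> s p) - (\<omega> s (r' s) p - \<eta>' s p)\<bar> \<le> d * (rate_diff s * weight_diff s)"
      if "s \<in> {0..t}" for s
    proof -
      have s: "s \<in> {0..T}" using that t by auto
      note st = invariant_state(2)[OF inv s] invariant_state(2)[OF inv' s]
      have "L2_norm M (\<lambda>x. r s x - r' s x) \<le> d * weight_diff s * N"
        using st r[OF s] by (intro dominated_L2(2) borel_measurable_diff) (auto simp: bounded_state_def)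
      then have "\<bar>\<omega> s (r s) p - \<omega> s (r' s) p\<bar> \<le> L\<omega> * (d * weight_diff s * N)"
        using \<omega>_Lipschitz[OF s st[THEN bounded_state_L2] p] L\<omega>_nonneg
        by (meson mult_left_mono order_trans)
      then have "\<bar>(\<omega> s (r s) p - \<eta> s p) - (\<omega> s (r' s) p - \<eta>' s p)\<bar>
          \<le> (L\<omega> * N + 1) * (d * weight_diff s)"
        using \<eta>[OF s p] by (simp add: algebra_simps)
      \<comment> \<open>The flux part of the rate is added as slack, and B s \<ge> 1 brings in the
        common factor.\<close>
      also have "\<dots> \<le> rate_diff s * (d * weight_diff s)"
        using rate_nonneg[OF s] rate_split[OF s] B_ge_1[OF s]
        by (intro mult_right_mono dw s) (simp add: algebra_simps)
      finally show ?thesis by (simp add: mult_ac)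
    qed
  qed (use t in auto)
  also have "\<dots> \<le> d * (weight_diff t / 2)"
    using mult_left_mono[OF w_le d] by simp
  finally show "\<bar>picard_\<eta> r \<eta> t p - picard_\<eta> r' \<eta>' t p\<bar> \<le> d / 2 * weight_diff t"
    using sub[OF source_integrable[OF inv p]] sub[OF source_integrable[OF inv' p]]
    by (simp add: picard_\<eta>_def Henstock_Kurzweil_Integration.integral_diff)
qed

section \<open>Convergence of the iterates\<close>

primrec iterate :: "nat \<Rightarrow> (real \<Rightarrow> 'a \<Rightarrow> real) \<times> (real \<Rightarrow> 'a \<times> 'a \<Rightarrow> real)" where
  "iterate 0 = (\<lambda>_. r0, \<lambda>_. \<eta>0)"
| "iterate (Suc n) = (picard_r (fst (iterate n)) (snd (iterate n)), picard_\<eta> (fst (iterate n)) (snd (iterate n)))"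

lemma iterate_invariant: "invariant (fst (iterate n)) (snd (iterate n))"
proof (induction n)
  case 0
  have inc: "0 \<le> modulus t - modulus s" if "0 \<le> s" "s \<le> t" "t \<le> T" for s t
    unfolding modulus_increment[OF that]
    using speed_nonneg integrable_subinterval_real[OF speed_integrable] that
    by (intro Henstock_Kurzweil_Integration.integral_nonneg) auto
  have "bounded_state (2 * weight_r t) (2 * source_size * weight_\<eta> t) r0 \<eta>0" if t: "t \<in> {0..T}" for t
  proof (rule bounded_state_mono)
    show "bounded_state 1 source_size r0 \<eta>0"
    proof -
      have "E0 \<le> source_size"
        using C\<omega>_nonneg T_pos by (simp add: source_size_def)
      then show ?thesis
        using \<eta>0_continuous \<eta>0_bound by (fastforce simp: bounded_state_def \<alpha>_def)
    qed
    show "1 \<le> 2 * weight_r t" using weight_r_ge_1[OF t] by simp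
    show "source_size \<le> 2 * source_size * weight_\<eta> t"
      using mult_left_mono[OF weight_\<eta>_ge_1[OF t], of "2 * source_size"] source_size_nonneg by simp
  qed
  then show ?case
    using inc \<alpha>_nonneg by (auto simp: invariant_def)
qed (simp add: picard_invariant)

text \<open>By the triangle inequality, twice the bound of a component dominates the difference of
  any two invariant pairs in it; the sum is one number for both components.\<close>

definition initial_gap :: real where
  "initial_gap = 2 * bound_r + 2 * bound_\<eta>"

lemma initial_gap_nonneg: "0 \<le> initial_gap"
  using bound_r_nonneg bound_\<eta>_nonneg by (simp add: initial_gap_def)

lemma iterate_increment:
  assumes "t \<in> {0..T}"
  shows "\<bar>fst (iterate (Suc n)) t x - fst (iterate n) t x\<bar> \<le> initial_gap * (1/2) ^ n * weight_diff t * \<alpha> x"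
    and "p \<in> offdiag \<Longrightarrow>
      \<bar>snd (iterate (Suc n)) t p - snd (iterate n) t p\<bar> \<le> initial_gap * (1/2) ^ n * weight_diff t"
proof -
  \<comment> \<open>The induction must cover all times and both components together, since the
    contraction at t uses all earlier times and couples r with \<eta>.\<close>
  have "\<forall>t\<in>{0..T}. (\<forall>x. \<bar>fst (iterate (Suc n)) t x - fst (iterate n) t x\<bar> \<le> initial_gap * (1/2) ^ n * weight_diff t * \<alpha> x) \<and>
    (\<forall>p\<in>offdiag. \<bar>snd (iterate (Suc n)) t p - snd (iterate n) t p\<bar> \<le> initial_gap * (1/2) ^ n * weight_diff t)"
  proof (induction n)
    case 0
    show ?case
    proof (intro ballI conjI allI)
      fix t assume t: "t \<in> {0..T}"
      have gap: "initial_gap \<le> initial_gap * (1/2) ^ 0 * weight_diff t"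
        using mult_left_mono[OF weight_diff_ge_1[OF t] initial_gap_nonneg] by simp
      note st = invariant_state(2)[OF iterate_invariant t]
      show "\<bar>fst (iterate (Suc 0)) t x - fst (iterate 0) t x\<bar> \<le> initial_gap * (1/2) ^ 0 * weight_diff t * \<alpha> x" for x
      proof -
        have "\<bar>fst (iterate (Suc 0)) t x\<bar> \<le> bound_r * \<alpha> x" "\<bar>fst (iterate 0) t x\<bar> \<le> bound_r * \<alpha> x"
          using st by (auto simp: bounded_state_def simp del: iterate.simps)
        then have "\<bar>fst (iterate (Suc 0)) t x - fst (iterate 0) t x\<bar> \<le> 2 * bound_r * \<alpha> x"
          by linarith
        also have "\<dots> \<le> initial_gap * \<alpha> x"
          using bound_\<eta>_nonneg \<alpha>_nonneg by (intro mult_right_mono) (auto simp: initial_gap_def)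
        also have "\<dots> \<le> initial_gap * (1/2) ^ 0 * weight_diff t * \<alpha> x"
          by (intro mult_right_mono gap \<alpha>_nonneg)
        finally show ?thesis .
      qed
      show "\<bar>snd (iterate (Suc 0)) t p - snd (iterate 0) t p\<bar> \<le> initial_gap * (1/2) ^ 0 * weight_diff t"
        if p: "p \<in> offdiag" for p
      proof -
        have "\<bar>snd (iterate (Suc 0)) t p\<bar> \<le> bound_\<eta>" "\<bar>snd (iterate 0) t p\<bar> \<le> bound_\<eta>"
          using st p by (auto simp: bounded_state_def simp del: iterate.simps)
        then have "\<bar>snd (iterate (Suc 0)) t p - snd (iterate 0) t p\<bar> \<le> initial_gap"
          unfolding initial_gap_def using bound_r_nonneg by linarith
        with gap show ?thesis by linarith
      qed
    qed
  next
    case (Suc n)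
    have d: "0 \<le> initial_gap * (1/2) ^ n" using initial_gap_nonneg by simp
    note c = picard_contraction[OF iterate_invariant[of "Suc n"] iterate_invariant[of n] d]
    show ?case
      unfolding iterate.simps(2)[of "Suc n"] fst_conv snd_conv
      using Suc c by (subst (1 3) iterate.simps(2)) simp
  qed
  with assms show "\<bar>fst (iterate (Suc n)) t x - fst (iterate n) t x\<bar> \<le> initial_gap * (1/2) ^ n * weight_diff t * \<alpha> x"
    and "p \<in> offdiag \<Longrightarrow>
      \<bar>snd (iterate (Suc n)) t p - snd (iterate n) t p\<bar> \<le> initial_gap * (1/2) ^ n * weight_diff t"
    by blast+
qed

definition limit_r :: "real \<Rightarrow> 'a \<Rightarrow> real" where
  "limit_r t x = lim (\<lambda>n. fst (iterate n) t x)"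

definition limit_\<eta> :: "real \<Rightarrow> 'a \<times> 'a \<Rightarrow> real" where
  "limit_\<eta> t p = lim (\<lambda>n. snd (iterate n) t p)"

lemma iterate_limit_bound:
  assumes t: "t \<in> {0..T}"
  shows "\<bar>fst (iterate n) t x - limit_r t x\<bar> \<le> 2 * initial_gap * (1/2) ^ n * weight_diff t * \<alpha> x"
    and "p \<in> offdiag \<Longrightarrow> \<bar>snd (iterate n) t p - limit_\<eta> t p\<bar> \<le> 2 * initial_gap * (1/2) ^ n * weight_diff t"
proof -
  have "\<bar>fst (iterate n) t x - limit_r t x\<bar> \<le> 2 * (initial_gap * weight_diff t * \<alpha> x) * (1/2) ^ n"
    unfolding limit_r_def
    by (rule geometric_increments) (use iterate_increment(1)[OF t] in \<open>simp add: mult_ac\<close>)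
  then show "\<bar>fst (iterate n) t x - limit_r t x\<bar> \<le> 2 * initial_gap * (1/2) ^ n * weight_diff t * \<alpha> x"
    by (simp add: mult_ac)
  assume p: "p \<in> offdiag"
  have "\<bar>snd (iterate n) t p - limit_\<eta> t p\<bar> \<le> 2 * (initial_gap * weight_diff t) * (1/2) ^ n"
    unfolding limit_\<eta>_def
    by (rule geometric_increments) (use iterate_increment(2)[OF t p] in \<open>simp add: mult_ac\<close>)
  then show "\<bar>snd (iterate n) t p - limit_\<eta> t p\<bar> \<le> 2 * initial_gap * (1/2) ^ n * weight_diff t"
    by (simp add: mult_ac)
qed

lemma iterate_tendsto:
  assumes t: "t \<in> {0..T}"
  shows "(\<lambda>n. fst (iterate n) t x) \<longlonglongrightarrow> limit_r t x"
    and "p \<in> offdiag \<Longrightarrow> (\<lambda>n. snd (iterate n) t p) \<longlonglongrightarrow> limit_\<eta> t p"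
proof -
  show "(\<lambda>n. fst (iterate n) t x) \<longlonglongrightarrow> limit_r t x"
    by (rule geometric_bound_tendsto[where c="2 * initial_gap * weight_diff t * \<alpha> x"])
      (use iterate_limit_bound(1)[OF t] in \<open>simp add: mult_ac\<close>)
  assume p: "p \<in> offdiag"
  show "(\<lambda>n. snd (iterate n) t p) \<longlonglongrightarrow> limit_\<eta> t p"
    by (rule geometric_bound_tendsto[where c="2 * initial_gap * weight_diff t"])
      (use iterate_limit_bound(2)[OF t p] in \<open>simp add: mult_ac\<close>)
qed

text \<open>At a fixed time the convergence of \<eta> is uniform on \<open>offdiag\<close>, as its
  error bound carries no weight depending on the point.\<close>

lemma limit_\<eta>_continuous:
  assumes t: "t \<in> {0..T}"
  shows "continuous_on offdiag (limit_\<eta> t)"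
proof (rule uniform_limit_theorem)
  show "\<forall>\<^sub>F n in sequentially. continuous_on offdiag (snd (iterate n) t)"
    using invariant_state(2)[OF iterate_invariant t] by (simp add: bounded_state_def)
  show "uniform_limit offdiag (\<lambda>n. snd (iterate n) t) (limit_\<eta> t) sequentially"
    unfolding uniform_limit_iff
  proof (intro allI impI)
    fix e :: real assume "0 < e"
    let ?c = "2 * initial_gap * weight_diff t"
    have "(\<lambda>n. ?c * (1/2) ^ n) \<longlonglongrightarrow> ?c * 0"
      by (intro tendsto_intros LIMSEQ_realpow_zero) auto
    then have "\<forall>\<^sub>F n in sequentially. ?c * (1/2) ^ n < e"
      by (rule order_tendstoD) (use \<open>0 < e\<close> in simp)
    then show "\<forall>\<^sub>F n in sequentially. \<forall>p\<in>offdiag. dist (snd (iterate n) t p) (limit_\<eta> t p) < e"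
    proof eventually_elim
      case (elim n)
      show ?case
      proof
        fix p :: "'a \<times> 'a" assume "p \<in> offdiag"
        from iterate_limit_bound(2)[OF t this, of n] elim
        show "dist (snd (iterate n) t p) (limit_\<eta> t p) < e"
          by (simp add: dist_real_def mult_ac)
      qed
    qed
  qed
qed simp

text \<open>The bounds are non-strict inequalities uniform in n, so they survive pointwise limits.
  This makes the limit an admissible argument of the Picard map and of the contraction
  estimate.\<close>

lemma limit_invariant: "invariant limit_r limit_\<eta>"
  unfolding invariant_def
proof (intro conjI ballI allI impI)
  note inv = iterate_invariant[unfolded invariant_def]
  {
    fix t assume t: "t \<in> {0..T}"
    have st: "bounded_state (2 * weight_r t) (2 * source_size * weight_\<eta> t) (fst (iterate n) t) (snd (iterate n) t)" for n
      using inv[of n] t by blast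
    show "bounded_state (2 * weight_r t) (2 * source_size * weight_\<eta> t) (limit_r t) (limit_\<eta> t)"
      unfolding bounded_state_def
    proof (intro conjI allI ballI limit_\<eta>_continuous t)
      show "limit_r t \<in> borel_measurable M"
      proof (rule borel_measurable_LIMSEQ_real)
        show "(\<lambda>n. fst (iterate n) t x) \<longlonglongrightarrow> limit_r t x" for x
          by (rule iterate_tendsto(1)[OF t])
        show "fst (iterate n) t \<in> borel_measurable M" for n
          using st[of n] by (simp add: bounded_state_def)
      qed
      show "\<bar>limit_r t x\<bar> \<le> 2 * weight_r t * \<alpha> x" for x
        by (rule LIMSEQ_le_const2[OF tendsto_rabs[OF iterate_tendsto(1)[OF t]]])
          (use st in \<open>simp add: bounded_state_def\<close>)
      show "\<bar>limit_\<eta> t p\<bar> \<le> 2 * source_size * weight_\<eta> t" if "p \<in> offdiag" for p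
        by (rule LIMSEQ_le_const2[OF tendsto_rabs[OF iterate_tendsto(2)[OF t that]]])
          (use st that in \<open>simp add: bounded_state_def\<close>)
    qed
  next
    fix s t x assume st: "0 \<le> s" "s \<le> t" "t \<le> T"
    then have s: "s \<in> {0..T}" and t: "t \<in> {0..T}" by auto
    show "\<bar>limit_r t x - limit_r s x\<bar> \<le> (modulus t - modulus s) * \<alpha> x"
      by (rule LIMSEQ_le_const2[OF tendsto_rabs[OF tendsto_diff[OF iterate_tendsto(1)[OF t] iterate_tendsto(1)[OF s]]]])
        (use inv st in blast)
  next
    fix s t p assume st: "0 \<le> s" "s \<le> t" "t \<le> T" and p: "p \<in> (offdiag :: ('a \<times> 'a) set)"
    then have s: "s \<in> {0..T}" and t: "t \<in> {0..T}" by auto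
    show "\<bar>limit_\<eta> t p - limit_\<eta> s p\<bar> \<le> modulus t - modulus s"
      by (rule LIMSEQ_le_const2[OF tendsto_rabs[OF tendsto_diff[OF iterate_tendsto(2)[OF t p] iterate_tendsto(2)[OF s p]]]])
        (use inv st p in blast)
  }
qed

text \<open>Contraction is applied to the n-th iterate and the limit: the shifted iterates converge
  to the Picard image of the limit as well as to the limit itself.\<close>

lemma limit_fixed_point:
  assumes t: "t \<in> {0..T}"
  shows "limit_r t x = picard_r limit_r limit_\<eta> t x"
    and "p \<in> offdiag \<Longrightarrow> limit_\<eta> t p = picard_\<eta> limit_r limit_\<eta> t p"
proof -
  have d: "0 \<le> 2 * initial_gap * (1/2) ^ n" for n
    using initial_gap_nonneg by simp
  have c_r: "\<bar>picard_r (fst (iterate n)) (snd (iterate n)) t x - picard_r limit_r limit_\<eta> t x\<bar>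
      \<le> 2 * initial_gap * (1/2) ^ n / 2 * weight_diff t * \<alpha> x" for n
    by (rule picard_contraction(1)[OF iterate_invariant limit_invariant d _ _ t])
      (rule iterate_limit_bound; assumption)+
  have c_\<eta>: "\<bar>picard_\<eta> (fst (iterate n)) (snd (iterate n)) t p - picard_\<eta> limit_r limit_\<eta> t p\<bar>
      \<le> 2 * initial_gap * (1/2) ^ n / 2 * weight_diff t" if "p \<in> offdiag" for n
    by (rule picard_contraction(2)[OF iterate_invariant limit_invariant d _ _ t that])
      (rule iterate_limit_bound; assumption)+
  have "(\<lambda>n. fst (iterate (Suc n)) t x) \<longlonglongrightarrow> picard_r limit_r limit_\<eta> t x"
    by (rule geometric_bound_tendsto[where c="initial_gap * weight_diff t * \<alpha> x"])
      (use c_r in \<open>simp add: mult_ac\<close>)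
  with LIMSEQ_Suc[OF iterate_tendsto(1)[OF t]]
  show "limit_r t x = picard_r limit_r limit_\<eta> t x"
    by (rule LIMSEQ_unique)
  assume p: "p \<in> offdiag"
  have "(\<lambda>n. snd (iterate (Suc n)) t p) \<longlonglongrightarrow> picard_\<eta> limit_r limit_\<eta> t p"
    by (rule geometric_bound_tendsto[where c="initial_gap * weight_diff t"])
      (use c_\<eta>[OF p] in \<open>simp add: mult_ac\<close>)
  with LIMSEQ_Suc[OF iterate_tendsto(2)[OF t p]]
  show "limit_\<eta> t p = picard_\<eta> limit_r limit_\<eta> t p"
    by (rule LIMSEQ_unique)
qed

section \<open>From the fixed point to a solution\<close>

text \<open>The premise is written in the shape that the spike rules ask for, with exceptional set
  \<open>{0..T} - S\<close>.\<close>

lemma flux_integral_spike: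
  assumes "s \<in> {0..T} - ({0..T} - S)"
  shows "flux_integral M \<Phi> V r \<eta> s x = cut_flux r \<eta> s x"
  using assms by (simp add: flux_integral_eq cut_flux_def)

lemma invariant_AC_r:
  assumes inv: "invariant r \<eta>"
  shows "AC_curve T (L2 M) (L2_norm M) r"
  unfolding AC_curve_def
\<comment> \<open>Integrating the pointwise increment bound, weighted by \<alpha>, over space
  produces the factor N.\<close>
proof (intro conjI ballI exI[of _ "\<lambda>t. speed t * N"] allI impI)
  show "r t \<in> L2 M" if "t \<in> {0..T}" for t
    by (rule bounded_state_L2[OF invariant_state(2)[OF inv that]])
  have ai: "(\<lambda>t. speed t * N) absolutely_integrable_on {0..T}"
    using speed_nonneg N_nonneg
    by (intro nonnegative_absolutely_integrable_1 integrable_on_mult_left speed_integrable) auto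
  then show "(\<lambda>t. speed t * N) absolutely_integrable_on {0..T}" .
  fix s t assume st: "0 \<le> s \<and> s < t \<and> t \<le> T"
  have "L2_norm M (\<lambda>x. r t x - r s x) \<le> (modulus t - modulus s) * N"
  proof (rule dominated_L2(2))
    show "(\<lambda>x. r t x - r s x) \<in> borel_measurable M"
      using invariant_state(2)[OF inv, of t] invariant_state(2)[OF inv, of s] st
      by (intro borel_measurable_diff) (auto simp: bounded_state_def)
    show "\<bar>r t x - r s x\<bar> \<le> (modulus t - modulus s) * \<alpha> x" for x
      using inv st by (auto simp: invariant_def)
  qed
  also have "\<dots> = integral {s..t} (\<lambda>u. speed u * N)"
    using st by (simp add: modulus_increment)
  also have "\<dots> = (LINT u:{s..t}|lebesgue. speed u * N)"
    using st absolutely_integrable_on_subinterval[OF ai, of s t]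
    by (intro set_lebesgue_integral_eq_integral(2)[symmetric]) auto
  finally show "L2_norm M (\<lambda>x. r t x - r s x) \<le> (LINT u:{s..t}|lebesgue. speed u * N)" .
qed

lemma invariant_AC_\<eta>:
  assumes inv: "invariant r \<eta>"
  shows "AC_curve T Cb_offdiag sup_norm \<eta>"
  unfolding AC_curve_def
proof (intro conjI ballI exI[of _ speed] allI impI)
  show "\<eta> t \<in> Cb_offdiag" if "t \<in> {0..T}" for t
    using invariant_state(2)[OF inv that]
    by (auto simp: bounded_state_def Cb_offdiag_def bounded_iff)
  have ai: "speed absolutely_integrable_on {0..T}"
    by (rule nonnegative_absolutely_integrable_1[OF speed_integrable speed_nonneg])
  then show "speed absolutely_integrable_on {0..T}" .
  fix s t assume st: "0 \<le> s \<and> s < t \<and> t \<le> T"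
  have "sup_norm (\<lambda>z. \<eta> t z - \<eta> s z) \<le> modulus t - modulus s"
    unfolding sup_norm_def
    using inv st by (intro cSUP_least offdiag_nonempty) (auto simp: invariant_def)
  also have "\<dots> = integral {s..t} speed"
    using st by (simp add: modulus_increment)
  also have "\<dots> = (LINT u:{s..t}|lebesgue. speed u)"
    using st absolutely_integrable_on_subinterval[OF ai, of s t]
    by (intro set_lebesgue_integral_eq_integral(2)[symmetric]) auto
  finally show "sup_norm (\<lambda>z. \<eta> t z - \<eta> s z) \<le> (LINT u:{s..t}|lebesgue. speed u)" .
qed

theorem solution_exists: "CoNCL_solution T M \<Phi> V \<omega> r0 \<eta>0 limit_r limit_\<eta>"
proof -
  note inv = limit_invariant
  note reg = invariant_regular[OF inv]
  have AE_S: "AE t in lebesgue_on {0..T}. t \<in> S"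
  proof -
    have "AE t in lebesgue. t \<notin> {0..T} - S"
      using S_full by (intro AE_not_in) (simp add: negligible_iff_null_sets)
    then show ?thesis
      by (subst AE_restrict_space_iff) auto
  qed
  have flux_int: "set_integrable M (UNIV - {x})
      (\<lambda>y. \<Phi> (limit_r t x) (limit_r t y) (V t (limit_r t) (x, y)) * limit_\<eta> t (x, y))" if "t \<in> S" for t x
    unfolding set_integrable_def flux_integrand
    using that S_subset by (intro flux_bound(1)[OF invariant_state(2)[OF inv]]) auto
  have flux_ai: "(\<lambda>t. flux_integral M \<Phi> V limit_r limit_\<eta> t x) absolutely_integrable_on {0..T}" for x
    by (rule absolutely_integrable_spike[OF cut_flux_absolutely_integrable[OF reg] S_full flux_integral_spike])
  have r_eq: "limit_r t x = r0 x - (LINT s:{0..t}|lebesgue. flux_integral M \<Phi> V limit_r limit_\<eta> s x)"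
    if t: "t \<in> {0..T}" for t x
  proof -
    have "(\<lambda>s. flux_integral M \<Phi> V limit_r limit_\<eta> s x) absolutely_integrable_on {0..t}"
      using t absolutely_integrable_on_subinterval[OF flux_ai] by auto
    then have "(LINT s:{0..t}|lebesgue. flux_integral M \<Phi> V limit_r limit_\<eta> s x)
        = integral {0..t} (\<lambda>s. flux_integral M \<Phi> V limit_r limit_\<eta> s x)"
      by (rule set_lebesgue_integral_eq_integral(2))
    also have "\<dots> = integral {0..t} (\<lambda>s. cut_flux limit_r limit_\<eta> s x)"
      \<comment> \<open>Restoring the true flux at times outside S changes the integrand only on a
        null set.\<close>
      using t by (intro integral_spike[OF S_full] flux_integral_spike[symmetric]) auto
    finally show ?thesis
      using limit_fixed_point(1)[OF t, of x] by (simp add: picard_r_def)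
  qed
  have \<eta>_eq: "limit_\<eta> t p = \<eta>0 p + (LINT s:{0..t}|lebesgue. \<omega> s (limit_r s) p - limit_\<eta> s p)"
    if t: "t \<in> {0..T}" and p: "p \<in> offdiag" for t p
  proof -
    have "(\<lambda>s. \<omega> s (limit_r s) p - limit_\<eta> s p) absolutely_integrable_on {0..t}"
      using t absolutely_integrable_on_subinterval[OF source_absolutely_integrable[OF reg p]] by auto
    then have "(LINT s:{0..t}|lebesgue. \<omega> s (limit_r s) p - limit_\<eta> s p)
        = integral {0..t} (\<lambda>s. \<omega> s (limit_r s) p - limit_\<eta> s p)"
      by (rule set_lebesgue_integral_eq_integral(2))
    then show ?thesis
      using limit_fixed_point(2)[OF t p] by (simp add: picard_\<eta>_def)
  qed
  show ?thesis
    unfolding CoNCL_solution_def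
  proof (intro conjI)
    show "AE x in M. AE t in lebesgue_on {0..T}. set_integrable M (UNIV - {x})
        (\<lambda>y. \<Phi> (limit_r t x) (limit_r t y) (V t (limit_r t) (x, y)) * limit_\<eta> t (x, y))"
      by (intro AE_I2 AE_mp[OF AE_S] impI flux_int)
    show "AE x in M. (\<lambda>t. flux_integral M \<Phi> V limit_r limit_\<eta> t x) absolutely_integrable_on {0..T}"
      by (intro AE_I2 flux_ai)
    show "\<forall>p\<in>offdiag. (\<lambda>t. \<omega> t (limit_r t) p - limit_\<eta> t p) absolutely_integrable_on {0..T}"
      by (intro ballI source_absolutely_integrable[OF reg])
    show "AE x in M. \<forall>t\<in>{0..T}.
        limit_r t x = r0 x - (LINT s:{0..t}|lebesgue. flux_integral M \<Phi> V limit_r limit_\<eta> s x)"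
      by (intro AE_I2 ballI r_eq)
    show "\<forall>t\<in>{0..T}. \<forall>p\<in>offdiag.
        limit_\<eta> t p = \<eta>0 p + (LINT s:{0..t}|lebesgue. \<omega> s (limit_r s) p - limit_\<eta> s p)"
      by (intro ballI \<eta>_eq)
  qed (rule invariant_AC_r[OF inv], rule invariant_AC_\<eta>[OF inv])
qed

end

section \<open>The theorem\<close>

theorem theorem3p1:
  fixes T C_V L_V L_\<omega> C_\<omega> :: real
    and M :: "(real ^ 'n) measure"
    and \<Phi> :: "real \<Rightarrow> real \<Rightarrow> real \<Rightarrow> real"
    and V \<omega> :: "real \<Rightarrow> (real ^ 'n \<Rightarrow> real) \<Rightarrow> (real ^ 'n) \<times> (real ^ 'n) \<Rightarrow> real"
    and r0 :: "real ^ 'n \<Rightarrow> real"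
    and \<eta>0 :: "(real ^ 'n) \<times> (real ^ 'n) \<Rightarrow> real"
  assumes "T > 0"
    and "prob_space M" and "sets M = sets borel" and "integrable M (\<lambda>x. (norm x)\<^sup>2)"
    and "flux_interpolation \<Phi>" and "jointly_antisym \<Phi>"
    and "r0 \<in> L2 M" and "\<eta>0 \<in> Cb_offdiag" and "sym_fun \<eta>0"
    and V_antisym: "\<And>t r. t \<in> {0..T} \<Longrightarrow> r \<in> L2 M \<Longrightarrow> antisym_fun (V t r)"
    and V_L2: "ae_invariant T M V"
    and V_measurable: "\<And>r. r \<in> L2 M \<Longrightarrow>
      (\<lambda>(t, p). V t r p) \<in> borel_measurable (lebesgue_on {0..T} \<Otimes>\<^sub>M restrict_space borel offdiag)"
    and "C_V > 0"
    and V_bound: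
      "((\<lambda>t. SUP r\<in>L2 M. sup_sq_integral M (V t r)) \<in> borel_measurable (lebesgue_on {0..T}) \<and>
        (\<integral>\<^sup>+ t \<in> {0..T}. (SUP r\<in>L2 M. sup_sq_integral M (V t r)) \<partial>lebesgue) \<le> ennreal C_V)
       \<or> (SUP t\<in>{0..T}. SUP r\<in>L2 M. sup_sq_integral M (V t r)) \<le> ennreal C_V"
    and "L_V > 0"
    and V_Lipschitz: "\<And>t g g'. t \<in> {0..T} \<Longrightarrow> g \<in> L2 M \<Longrightarrow> g' \<in> L2 M \<Longrightarrow>
      sup_sq_integral M (\<lambda>p. V t g p - V t g' p)
        \<le> ennreal (L_V * (L2_norm M (\<lambda>x. g x - g' x))\<^sup>2)"
    and \<omega>_L2: "ae_invariant T M \<omega>"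
    and \<omega>_continuous: "\<And>t r. t \<in> {0..T} \<Longrightarrow> r \<in> L2 M \<Longrightarrow> continuous_on offdiag (\<omega> t r)"
    and \<omega>_integrable: "\<And>r p. r \<in> L2 M \<Longrightarrow> p \<in> offdiag \<Longrightarrow>
      (\<lambda>t. \<omega> t r p) absolutely_integrable_on {0..T}"
    and "L_\<omega> \<ge> 0"
    and \<omega>_Lipschitz: "\<And>r r'. r \<in> L2 M \<Longrightarrow> r' \<in> L2 M \<Longrightarrow>
      (SUP t\<in>{0..T}. SUP p\<in>offdiag. ennreal \<bar>\<omega> t r p - \<omega> t r' p\<bar>)
        \<le> ennreal (L_\<omega> * L2_norm M (\<lambda>x. r x - r' x))"
    and "C_\<omega> > 0"
    and \<omega>_bound: "(SUP t\<in>{0..T}. SUP r\<in>L2 M. SUP p\<in>offdiag. ennreal \<bar>\<omega> t r p\<bar>) \<le> ennreal C_\<omega>"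
    and \<omega>_sym: "\<And>t r. t \<in> {0..T} \<Longrightarrow> r \<in> L2 M \<Longrightarrow> sym_fun (\<omega> t r)"
  shows "\<exists>r \<eta>. CoNCL_solution T M \<Phi> V \<omega> r0 \<eta>0 r \<eta>"
proof -
  note flux = \<open>flux_interpolation \<Phi>\<close>[unfolded flux_interpolation_def]
  then obtain L where L: "L > 0"
    and \<Phi>_lip: "\<forall>a b c d v w. \<bar>\<Phi> a b w - \<Phi> a b v\<bar> \<le> L * (\<bar>a\<bar> + \<bar>b\<bar>) * \<bar>w - v\<bar> \<and>
        \<bar>\<Phi> a b v - \<Phi> c d v\<bar> \<le> L * (\<bar>a - c\<bar> + \<bar>b - d\<bar>) * \<bar>v\<bar>"
    by (elim conjE exE) (rule that)
  have \<Phi>_meas: "(\<lambda>(a, b, v). \<Phi> a b v) \<in> borel_measurable borel"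
    using flux by (rule conjunct1)
  have \<Phi>_zero: "\<Phi> a b 0 = 0" for a b
    using flux by simp
  from \<open>\<eta>0 \<in> Cb_offdiag\<close> obtain E0 where E0: "0 < E0" "\<And>p. p \<in> offdiag \<Longrightarrow> \<bar>\<eta>0 p\<bar> \<le> E0"
    and \<eta>0_cont: "continuous_on offdiag \<eta>0"
    unfolding Cb_offdiag_def bounded_pos by auto
  \<comment> \<open>The function of time given to \<open>finite_rate_exists\<close> is the supremum
    over all densities and points, so one S and one B serve them all.\<close>
  obtain S B where S: "S \<in> sets lebesgue" "S \<subseteq> {0..T}" "negligible ({0..T} - S)"
    and B: "B integrable_on {0..T}" "\<And>t. t \<in> {0..T} \<Longrightarrow> 1 \<le> B t"
    and SB: "\<And>t. t \<in> S \<Longrightarrow> (SUP r\<in>L2 M. sup_sq_integral M (V t r)) \<le> ennreal ((B t)\<^sup>2)"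
    by (rule finite_rate_exists[OF V_bound less_imp_le[OF \<open>C_V > 0\<close>]]) (rule that)
  have sup_sq: "(\<integral>\<^sup>+ y \<in> UNIV - {x}. ennreal (\<bar>v (x, y)\<bar>\<^sup>2) \<partial>M) \<le> sup_sq_integral M v"
    for v :: "(real ^ 'n) \<times> (real ^ 'n) \<Rightarrow> real" and x
    unfolding sup_sq_integral_def by (rule SUP_upper) simp
  have norm_nonneg: "0 \<le> L2_norm M g" for g :: "real ^ 'n \<Rightarrow> real"
    by (simp add: L2_norm_def)
  interpret coNCL_data M \<Phi> V \<omega> T L L_V L_\<omega> C_\<omega> E0 r0 \<eta>0 S B
  proof (intro coNCL_data.intro coNCL_data_axioms.intro)
    show "prob_space M" by fact
    show "\<bar>\<Phi> a b w - \<Phi> a b v\<bar> \<le> L * (\<bar>a\<bar> + \<bar>b\<bar>) * \<bar>w - v\<bar>" for a b v w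
      using \<Phi>_lip by blast
    show "\<bar>\<Phi> a b v - \<Phi> c d v\<bar> \<le> L * (\<bar>a - c\<bar> + \<bar>b - d\<bar>) * \<bar>v\<bar>" for a b c d v
      using \<Phi>_lip by blast
    show "(\<integral>\<^sup>+ y \<in> UNIV - {x}. ennreal (\<bar>V t g (x, y)\<bar>\<^sup>2) \<partial>M) \<le> ennreal ((B t)\<^sup>2)"
      if "t \<in> S" "g \<in> L2 M" for t g x
      using sup_sq[where x=x and v="V t g"] SUP_upper[OF that(2), of "\<lambda>r. sup_sq_integral M (V t r)"] SB[OF that(1)]
      by (meson order_trans)
    show "(\<integral>\<^sup>+ y \<in> UNIV - {x}. ennreal (\<bar>V t g (x, y) - V t g' (x, y)\<bar>\<^sup>2) \<partial>M)
        \<le> ennreal (L_V * (L2_norm M (\<lambda>x. g x - g' x))\<^sup>2)"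
      if "t \<in> {0..T}" "g \<in> L2 M" "g' \<in> L2 M" for t g g' x
      using sup_sq[where x=x and v="\<lambda>p. V t g p - V t g' p"] V_Lipschitz[OF that] by (rule order_trans)
    show "(\<lambda>t. \<omega> t g p) \<in> borel_measurable (lebesgue_on {0..T})" if "g \<in> L2 M" "p \<in> offdiag" for g p
    proof (rule borel_measurable_integrable)
      show "integrable (lebesgue_on {0..T}) (\<lambda>t. \<omega> t g p)"
        using \<omega>_integrable[OF that] by (simp add: integrable_restrict_space set_integrable_def)
    qed
    show "\<bar>\<omega> t g p - \<omega> t g' p\<bar> \<le> L_\<omega> * L2_norm M (\<lambda>x. g x - g' x)"
      if "t \<in> {0..T}" "g \<in> L2 M" "g' \<in> L2 M" "p \<in> offdiag" for t g g' p
    proof -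
      have "ennreal \<bar>\<omega> t g p - \<omega> t g' p\<bar> \<le> (SUP t\<in>{0..T}. SUP p\<in>offdiag. ennreal \<bar>\<omega> t g p - \<omega> t g' p\<bar>)"
        by (intro SUP_upper2[OF that(1)] SUP_upper2[OF that(4)] order_refl)
      also note \<omega>_Lipschitz[OF that(2,3)]
      finally show ?thesis
        using \<open>L_\<omega> \<ge> 0\<close> norm_nonneg by (subst (asm) ennreal_le_iff) auto
    qed
    show "\<bar>\<omega> t g p\<bar> \<le> C_\<omega>" if "t \<in> {0..T}" "g \<in> L2 M" "p \<in> offdiag" for t g p
    proof -
      have "ennreal \<bar>\<omega> t g p\<bar> \<le> (SUP t\<in>{0..T}. SUP r\<in>L2 M. SUP p\<in>offdiag. ennreal \<bar>\<omega> t r p\<bar>)"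
        by (intro SUP_upper2[OF that(1)] SUP_upper2[OF that(2)] SUP_upper2[OF that(3)] order_refl)
      also note \<omega>_bound
      finally show ?thesis
        using \<open>C_\<omega> > 0\<close> by (subst (asm) ennreal_le_iff) auto
    qed
  qed (use assms(1,3,7) L \<Phi>_meas \<Phi>_zero E0 \<eta>0_cont V_measurable \<open>L_V > 0\<close> S B \<omega>_continuous \<open>L_\<omega> \<ge> 0\<close> \<open>C_\<omega> > 0\<close>
      in \<open>auto intro: less_imp_le\<close>)
  show ?thesis
    using solution_exists by blast
qed

end
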